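(* Let $x>0$. (a) If $\rho>0$ and $k\ge 0$ is real (not necessarily an integer), then $${}_1\Psi_1(\rho,k;\rho,0;x)=\int_0^\infty e^{-\tau}\tau^{k-1}\,\phi(\rho,0;x\tau^{\rho})\,d\tau .$$ (b) If $\rho\in(-1,0)$ and $k\in\{0,1,2,\ldots\}$, then $${}_1\Psi_1(\rho,k;\rho,0;-x)=\int_0^\infty e^{-\tau}\tau^{k-1}\,\phi(\rho,0;-x\tau^{\rho})\,d\tau .$$
   Context: For real $\rho\in(-1,0)\cup(0,\infty)$ and real $z$, the Wright function is ${}_1\Psi_1(\rho,k;\rho,0;z)=\sum_{n=0}^\infty \frac{\Gamma(k+\rho n)}{\Gamma(\rho n)}\frac{z^n}{n!}$. Where numerator and denominator gamma functions are singular at the same point, the quotient is understood by a limiting procedure; thus for a non-negative integer $k$ it is the product $\prod_{j=0}^{k-1}(\rho n+j)$, which equals $1$ when $k=0$, so that ${}_1\Psi_1(\rho,0;\rho,0;z)=e^z$. When $k\neq 0$ the term $n=0$ is $0$. The reduced Wright function is $\phi(\rho,0;z)=\sum_{n=1}^\infty \frac{z^n}{n!\,\Gamma(\rho n)}$, where $1/\Gamma$ is the entire reciprocal gamma function (equal to $0$ at $0,-1,-2,\ldots$).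
   Formalization: In (a) the printed identity fails at k = 0, since the integral equals e^x − 1 while the Wright function equals e^x; the formal statement therefore has the Wright function minus 1 for k = 0 in (a), and the printed identity for every k > 0. *)

theory Defs
  imports "HOL-Analysis.Analysis"
begin

text \<open>
  The quotient \<open>\<Gamma>(a + k) / \<Gamma>(a)\<close>. If only \<open>a\<close> is a pole, it is \<open>0\<close> (via \<^const>\<open>rGamma\<close>); if
  \<open>a\<close> and \<open>a + k\<close> are both poles, it is the limit for \<open>t \<rightarrow> a\<close> with \<open>k\<close> fixed.
  If only \<open>a + k\<close> is a pole, the quotient is not mathematically defined and the value below is
  junk; this never happens for \<open>a = \<rho> n\<close> with \<open>\<rho> > 0\<close> and \<open>k \<ge> 0\<close>, nor for natural \<open>k\<close>.
\<close>

definition Gamma_quotient :: "real \<Rightarrow> real \<Rightarrow> real" where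
  "Gamma_quotient a k =
     (if a \<in> \<int>\<^sub>\<le>\<^sub>0 \<and> a + k \<in> \<int>\<^sub>\<le>\<^sub>0
      then Lim (at a) (\<lambda>t. Gamma (t + k) / Gamma t)
      else Gamma (a + k) * rGamma a)"

text \<open>The Wright function \<open>\<^sub>1\<Psi>\<^sub>1(\<rho>,k;\<rho>,0;z)\<close>.\<close>

definition Wright_Psi :: "real \<Rightarrow> real \<Rightarrow> real \<Rightarrow> real" where
  "Wright_Psi \<rho> k z = (\<Sum>n. Gamma_quotient (\<rho> * real n) k * z ^ n / fact n)"

text \<open>The reduced Wright function \<open>\<phi>(\<rho>,0;z)\<close>; its series starts at exponent \<open>1\<close>.\<close>

definition Wright_phi :: "real \<Rightarrow> real \<Rightarrow> real" where
  "Wright_phi \<rho> z = (\<Sum>n. z ^ Suc n / fact (Suc n) * rGamma (\<rho> * real (Suc n)))"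

lemma Gamma_quotient_of_nat:
  "Gamma_quotient a (real k) = (\<Prod>j<k. a + real j)"
proof -
  have poch: "pochhammer t k = (\<Prod>j<k. t + real j)" for t :: real
    by (simp add: pochhammer_prod atLeast0LessThan)
  show ?thesis
  proof (cases "a \<in> \<int>\<^sub>\<le>\<^sub>0")
    case False
    then show ?thesis
      by (simp add: Gamma_quotient_def rGamma_inverse_Gamma pochhammer_Gamma
            divide_inverse flip: poch)
  next
    case a: True
    show ?thesis
    proof (cases "a + real k \<in> \<int>\<^sub>\<le>\<^sub>0")
      case False
      obtain m where m: "a = - real m"
        using a by (auto elim!: nonpos_Ints_cases')
      have "m < k"
        using False m
        by (metis add.commute add_uminus_conv_diff minus_diff_eq nonpos_Ints_of_int linorder_not_le
            minus_of_nat_in_nonpos_Ints of_nat_diff)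
      then have "(\<Prod>j<k. a + real j) = 0"
        using m by (intro prod_zero) auto
      moreover have "rGamma a = 0"
        using a by (simp add: rGamma_eq_zero_iff)
      ultimately show ?thesis
        using False unfolding Gamma_quotient_def by (metis mult_zero_right)
    next
      case True
      have "eventually (\<lambda>t. t \<notin> \<int>\<^sub>\<le>\<^sub>0) (at a)"
      proof -
        have "\<forall>\<^sub>F t in at a. t \<in> ball a 1 - {a}"
          by (intro eventually_at_in_open) auto
        then show ?thesis
        proof eventually_elim
          case (elim t)
          obtain m :: nat where "a = - real m"
            using a by (auto elim!: nonpos_Ints_cases')
          then show ?case
            using elim by (auto simp: dist_real_def elim!: nonpos_Ints_cases')
        qed
      qed
      then have "\<forall>\<^sub>F t in at a. (\<Prod>j<k. t + real j) = Gamma (t + real k) / Gamma t"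
        by eventually_elim (simp add: pochhammer_Gamma flip: poch)
      moreover have "((\<lambda>t. \<Prod>j<k. t + real j) \<longlongrightarrow> (\<Prod>j<k. a + real j)) (at a)"
        by (intro tendsto_intros)
      ultimately have "((\<lambda>t. Gamma (t + real k) / Gamma t) \<longlongrightarrow> (\<Prod>j<k. a + real j)) (at a)"
        by (rule Lim_transform_eventually[rotated])
      then show ?thesis
        using a True by (simp add: Gamma_quotient_def tendsto_Lim)
    qed
  qed
qed

lemma Gamma_quotient_0_left:
  assumes "k > 0"
  shows "Gamma_quotient 0 k = 0"
  using assms by (auto simp: Gamma_quotient_def elim!: nonpos_Ints_cases)

lemma Wright_Psi_0: "Wright_Psi \<rho> 0 z = exp z"
  using Gamma_quotient_of_nat[of _ 0]
  by (simp add: Wright_Psi_def exp_def divide_inverse mult.commute)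

end

theory Submission
  imports Defs "HOL-Complex_Analysis.Complex_Analysis" "HOL-Real_Asymp.Real_Asymp"
begin

text \<open>
  For \<open>\<rho> > 0\<close> the series of \<open>\<phi>\<close> has positive terms and is integrated term by term.

  For \<open>\<rho> = -\<sigma>\<close> with \<open>0 < \<sigma> < 1\<close> termwise integration diverges at \<open>\<tau> = 0\<close>. Instead, Hankel's integral for
  \<open>1/\<Gamma>\<close>, written in the coordinate \<open>z = e\<^sup>w\<close> so that no branch of \<open>z\<^sup>\<sigma>\<close> has to be chosen, gives
  \<open>\<phi>(-\<sigma>,0;-x\<tau>\<^bsup>-\<sigma>\<^esup>)/\<tau> = \<pi>\<^sup>-\<^sup>1 Im \<integral> e\<^sup>w exp(\<tau>e\<^sup>w - x e\<^bsup>\<sigma>w\<^esup>) dw\<close> over a line \<open>Im w = \<theta>\<close> with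
  \<open>\<pi>/2 < \<theta> < \<pi>\<close> and \<open>\<sigma>\<theta> < \<pi>/2\<close>. On this line both exponentials decay, so Fubini applies, and Cauchy's formula
  on the strip \<open>\<bar>Im w\<bar> \<le> \<theta>\<close> shows that the Laplace transform at \<open>q\<close> is \<open>exp(-x q\<^sup>\<sigma>)\<close>. Expanding
  both sides in powers of \<open>1 - q\<close> and comparing coefficients yields the statement for every \<open>k\<close>.
\<close>

section \<open>Gamma integrals\<close>

lemma
  fixes a :: real
  assumes a: "a > 0"
  shows set_integrable_Gamma: "set_integrable lborel {0<..} (\<lambda>t. t powr (a - 1) / exp t)"
    and set_integral_Gamma: "(LINT t:{0<..}|lborel. t powr (a - 1) / exp t) = Gamma a"
proof -
  have "((\<lambda>t. if t \<in> {0<..} then t powr (a - 1) / exp t else 0) has_integral Gamma a) {0..}"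
    by (rule has_integral_spike[of "{0}", OF _ _ Gamma_integral_real[OF a]]) auto
  then have *: "((\<lambda>t. t powr (a - 1) / exp t) has_integral Gamma a) {0<..}"
    by (subst (asm) has_integral_restrict) auto
  then have "(\<lambda>t. t powr (a - 1) / exp t) absolutely_integrable_on {0<..}"
    by (intro nonnegative_absolutely_integrable_1) (auto simp: integrable_on_def)
  then show int: "set_integrable lborel {0<..} (\<lambda>t. t powr (a - 1) / exp t)"
    unfolding set_integrable_def by (subst (asm) integrable_completion) auto
  show "(LINT t:{0<..}|lborel. t powr (a - 1) / exp t) = Gamma a"
    using set_borel_integral_eq_integral(2)[OF int] integral_unique[OF *] by simp
qed

text \<open>Euler's integral in the logarithmic coordinate \<open>t = exp u\<close>: since
  \<open>dt / t = du\<close>, the power \<open>t powr (a - 1)\<close> becomes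
  \<open>exp (a * u)\<close>.\<close>

lemma
  fixes a :: real
  assumes a: "a > 0"
  shows integrable_Gamma_exp: "integrable lborel (\<lambda>u. exp (a * u) * exp (- exp u))"
    and integral_Gamma_exp: "(LINT u|lborel. exp (a * u) * exp (- exp u)) = Gamma a"
proof -
  let ?f = "\<lambda>u::real. exp (a * u) * exp (- exp u)"
  have eq: "?f (ln t) * (1 / t) = t powr (a - 1) / exp t" if "t > 0" for t
    using that by (simp add: powr_diff powr_def exp_diff exp_minus field_simps)
  have int2: "set_integrable lborel {0<..} (\<lambda>t. ?f (ln t) * (1 / t))"
    using set_integrable_Gamma[OF a] by (rule set_integrable_cong[THEN iffD2, rotated 3]) (use eq in auto)
  have A: "((ereal \<circ> ln \<circ> real_of_ereal) \<longlongrightarrow> -\<infinity>) (at_right 0)"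
    unfolding zero_ereal_def ereal_tendsto_simps
    by (simp add: ln_at_0)
  have B: "((ereal \<circ> ln \<circ> real_of_ereal) \<longlongrightarrow> \<infinity>) (at_left \<infinity>)"
    unfolding ereal_tendsto_simps by (simp add: ln_at_top)
  note * = interval_integral_substitution_nonneg[of 0 \<infinity> ln "\<lambda>t. 1 / t" ?f "-\<infinity>" \<infinity>]
  have e0: "einterval 0 \<infinity> = {0<..}" "einterval (-\<infinity>) \<infinity> = UNIV"
    by (auto simp: einterval_def zero_ereal_def)
  have pos: "0 \<le> 1 / x" if "0 \<le> ereal x" for x
    using that by (auto simp: zero_ereal_def)
  have 1: "set_integrable lborel (einterval (-\<infinity>) \<infinity>) ?f"
    using int2 pos
    by (intro *(1) A B)
      (auto simp: e0 zero_ereal_def intro!: derivative_eq_intros continuous_intros simp: divide_inverse)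
  have 2: "(LBINT u=-\<infinity>..\<infinity>. ?f u) = (LBINT t=0..\<infinity>. ?f (ln t) * (1 / t))"
    using int2 pos
    by (intro *(2) A B)
      (auto simp: e0 zero_ereal_def intro!: derivative_eq_intros continuous_intros simp: divide_inverse)
  show "integrable lborel ?f"
    using 1 by (simp add: e0 set_integrable_def)
  have "(LINT u|lborel. ?f u) = (LBINT t:{0<..}. ?f (ln t) * (1 / t))"
    using 2 by (simp add: interval_lebesgue_integral_def e0 set_lebesgue_integral_def)
  also have "\<dots> = (LBINT t:{0<..}. t powr (a - 1) / exp t)"
    by (intro set_lebesgue_integral_cong allI impI) (use eq in auto)
  also have "\<dots> = Gamma a"
    by (rule set_integral_Gamma[OF a])
  finally show "(LINT u|lborel. ?f u) = Gamma a" .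
qed

text \<open>The affine change of variable \<open>ln b + \<sigma> * u\<close> reduces this to
  \<open>integrable_Gamma_exp\<close> with exponent \<open>a / \<sigma>\<close>. Functions of this
  form dominate the integrands on horizontal lines.\<close>

lemma integrable_exp_exp:
  fixes a b \<sigma> :: real
  assumes "a > 0" "b > 0" "\<sigma> > 0"
  shows "integrable lborel (\<lambda>u. exp (a * u) * exp (- b * exp (\<sigma> * u)))"
proof -
  have "integrable lborel (\<lambda>u. exp (a / \<sigma> * (ln b + \<sigma> * u)) * exp (- exp (ln b + \<sigma> * u)))"
    using lborel_integrable_real_affine[OF integrable_Gamma_exp[of "a / \<sigma>"], of \<sigma> "ln b"] assms
    by simp
  then have "integrable lborel (\<lambda>u. exp (- a / \<sigma> * ln b) *
      (exp (a / \<sigma> * (ln b + \<sigma> * u)) * exp (- exp (ln b + \<sigma> * u))))"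
    by (rule integrable_mult_right)
  also have "(\<lambda>u. exp (- a / \<sigma> * ln b) *
      (exp (a / \<sigma> * (ln b + \<sigma> * u)) * exp (- exp (ln b + \<sigma> * u))))
     = (\<lambda>u. exp (a * u) * exp (- b * exp (\<sigma> * u)))"
  proof
    fix u
    have "exp (- a / \<sigma> * ln b) * exp (a / \<sigma> * (ln b + \<sigma> * u)) = exp (a * u)"
      unfolding exp_add[symmetric] using assms by (simp add: field_simps)
    moreover have "exp (ln b + \<sigma> * u) = b * exp (\<sigma> * u)"
      using assms by (simp add: exp_add)
    ultimately show "exp (- a / \<sigma> * ln b) *
      (exp (a / \<sigma> * (ln b + \<sigma> * u)) * exp (- exp (ln b + \<sigma> * u))) = exp (a * u) * exp (- b * exp (\<sigma> * u))"
      by (metis mult.assoc mult_minus_left)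
  qed
  finally show ?thesis .
qed

section \<open>Shifting integrals along horizontal lines\<close>

lemma tendsto_integral_Icc:
  fixes f :: "real \<Rightarrow> 'a::{banach, second_countable_topology}"
  assumes f: "integrable lborel f"
  shows "(\<lambda>n. LINT x:{- real n..real n}|lborel. f x) \<longlonglongrightarrow> (LINT x|lborel. f x)"
  unfolding set_lebesgue_integral_def
proof (rule integral_dominated_convergence)
  show "integrable lborel (\<lambda>x. norm (f x))" using f by auto
  show "AE x in lborel. (\<lambda>n. indicat_real {- real n..real n} x *\<^sub>R f x) \<longlonglongrightarrow> f x"
  proof (rule AE_I2)
    fix x :: real
    have "eventually (\<lambda>n. \<bar>x\<bar> \<le> real n) sequentially"
      by (meson eventually_sequentiallyI nat_ceiling_le_eq)
    then show "(\<lambda>n. indicat_real {- real n..real n} x *\<^sub>R f x) \<longlonglongrightarrow> f x"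
      by (intro tendsto_eventually, elim eventually_mono) (auto simp: indicator_def)
  qed
  show "AE x in lborel. norm (indicat_real {- real n..real n} x *\<^sub>R f x) \<le> norm (f x)" for n
    by (auto simp: indicator_def)
qed (use f in auto)

lemma has_contour_integral_linepath_same_Im_iff:
  assumes "a < b"
  shows "(f has_contour_integral I) (linepath (Complex a c) (Complex b c)) \<longleftrightarrow>
           ((\<lambda>x. f (Complex x c)) has_integral I) {a..b}"
proof -
  have "(f has_contour_integral I) (linepath (Complex a c) (Complex b c)) \<longleftrightarrow>
          ((\<lambda>x. f (linepath (Complex a c) (Complex b c) x) * (Complex b c - Complex a c)) has_integral I) {0..1}"
    by (subst has_contour_integral_linepath) simp_all
  also have "\<dots> \<longleftrightarrow> ((\<lambda>x. f (Complex (a + (b - a) * x) c) * of_real (b - a)) has_integral I) {0..1}"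
    by (intro has_integral_cong arg_cong2[of _ _ _ _ "(*)"] arg_cong[of _ _ f])
       (auto simp: linepath_def complex_eq_iff algebra_simps)
  also have "{0..1} = (\<lambda>x. x / (b - a)) ` {0..b-a}"
    using assms by simp
  also have "((\<lambda>x. f (Complex (a + (b - a) * x) c) * of_real (b - a)) has_integral I) \<dots> \<longleftrightarrow>
             ((\<lambda>x. f (Complex (a + x) c) * of_real (b - a)) has_integral ((b-a) *\<^sub>R I)) {0..b-a}"
    by (subst has_integral_stretch_real_iff) (use assms in simp_all)
  also have "\<dots> \<longleftrightarrow> ((\<lambda>x. of_real (b-a) * f (Complex x c)) has_integral (b-a) *\<^sub>R I) {a..b}"
    by (subst has_integral_shift_real_ivl_iff[where c = "-a"])
       (simp_all add: scaleR_conv_of_real mult_ac)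
  also have "\<dots> \<longleftrightarrow> ((\<lambda>x. f (Complex x c)) has_integral I) {a..b}"
    by (subst has_integral_mult_right_iff) (use assms in \<open>auto simp: scaleR_conv_of_real\<close>)
  finally show ?thesis .
qed

text \<open>Cauchy's formula on rectangles with real parts from \<open>- n\<close> to
  \<open>n\<close>: as \<open>n\<close> grows, \<open>D\<close> makes the vertical sides vanish. The
  bound is demanded only for \<open>\<bar>u\<bar> \<ge> R\<close>, so that a neighbourhood of the
  pole \<open>p\<close> can be left out.\<close>

lemma strip_integral_difference:
  fixes F :: "complex \<Rightarrow> complex"
  defines "G \<equiv> \<lambda>p w. F w / (w - p)"
  assumes F: "F holomorphic_on {w. A < Im w \<and> Im w < B}"
    and strip: "A < \<alpha>" "\<alpha> < Im p" "Im p < \<beta>" "\<beta> < B"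
    and int: "integrable lborel (\<lambda>u. G p (Complex u \<alpha>))" "integrable lborel (\<lambda>u. G p (Complex u \<beta>))"
    and bound: "\<And>u v. \<bar>u\<bar> \<ge> R \<Longrightarrow> v \<in> {\<alpha>..\<beta>} \<Longrightarrow> norm (G p (Complex u v)) \<le> D u"
    and D: "(D \<longlongrightarrow> 0) at_top" "(D \<longlongrightarrow> 0) at_bot"
  shows "(LINT u|lborel. G p (Complex u \<alpha>)) - (LINT u|lborel. G p (Complex u \<beta>)) = 2 * pi * \<i> * F p"
proof -
  let ?S = "{w. A < Im w \<and> Im w < B}" and ?G = "G p"
  have S: "open ?S" "convex ?S"
    using convex_Int[OF convex_halfspace_Im_gt convex_halfspace_Im_lt, of A B]
      open_Int[OF open_halfspace_Im_gt open_halfspace_Im_lt, of A B]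
    by (simp_all add: Int_def)
  have contG: "continuous_on (?S - {p}) ?G"
    unfolding G_def using holomorphic_on_imp_continuous_on[OF F]
    by (auto intro!: continuous_intros elim: continuous_on_subset)
  define I where "I v n = (LINT u:{- real n..real n}|lborel. ?G (Complex u v))" for v n
  define V where "V u = contour_integral (linepath (Complex u \<alpha>) (Complex u \<beta>)) ?G" for u
  have hor: "(?G has_contour_integral I v n) (linepath (Complex (- real n) v) (Complex (real n) v))"
    if "n > 0" "integrable lborel (\<lambda>u. ?G (Complex u v))" for n v
    unfolding I_def
  proof (subst has_contour_integral_linepath_same_Im_iff)
    have "set_integrable lborel {- real n..real n} (\<lambda>u. ?G (Complex u v))"
      using that unfolding set_integrable_def by (intro integrable_mult_indicator) auto
    then show "((\<lambda>u. ?G (Complex u v)) has_integral (LINT u:{- real n..real n}|lborel. ?G (Complex u v))) {- real n..real n}"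
      using set_borel_integral_eq_integral has_integral_integral by metis
  qed (use that in auto)
  have ver: "(?G has_contour_integral V u) (linepath (Complex u \<alpha>) (Complex u \<beta>))" if "u \<noteq> Re p" for u
    unfolding V_def
    using that strip
    by (intro has_contour_integral_integral contour_integrable_continuous_linepath continuous_on_subset[OF contG])
       (auto simp: closed_segment_same_Re closed_segment_eq_real_ivl)
  \<comment> \<open>For \<open>real n > \<bar>Re p\<bar>\<close> the point \<open>p\<close> lies
    inside the rectangle. The counterclockwise orientation gives the lower and right sides a plus
    sign, the upper and left sides a minus sign.\<close>
  have main: "I \<alpha> n + V n - I \<beta> n - V (- real n) = 2 * pi * \<i> * F p" if n: "real n > \<bar>Re p\<bar>" for n
  proof -
    have c1: "(?G has_contour_integral (2*pi * \<i> * winding_number (rectpath (Complex (- real n) \<alpha>) (Complex n \<beta>)) p * F p))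
       (rectpath (Complex (- real n) \<alpha>) (Complex n \<beta>))"
      unfolding G_def using S F n strip
      by (intro Cauchy_integral_formula_convex_simple)
         (auto simp: path_image_rectpath interior_open)
    have w1: "winding_number (rectpath (Complex (- real n) \<alpha>) (Complex n \<beta>)) p = 1"
      using n strip by (intro winding_number_rectpath) (auto simp: in_box_complex_iff)
    have c2: "(?G has_contour_integral (I \<alpha> n + (V n + (- I \<beta> n + - V (- real n)))))
       (rectpath (Complex (- real n) \<alpha>) (Complex n \<beta>))"
      unfolding rectpath_def Let_def complex.sel
    proof (intro has_contour_integral_join has_contour_integral_reverse_linepath)
      have n0: "n > 0" using n by linarith
      show "(?G has_contour_integral I \<alpha> n) (linepath (Complex (- real n) \<alpha>) (Complex n \<alpha>))"
        by (rule hor[OF n0 int(1)])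
      show "(?G has_contour_integral I \<beta> n) (linepath (Complex (- real n) \<beta>) (Complex n \<beta>))"
        by (rule hor[OF n0 int(2)])
    qed (use n in \<open>auto intro: ver\<close>)
    show ?thesis
      using has_contour_integral_unique[OF c2 c1] unfolding w1 by (simp add: algebra_simps)
  qed
  have Vbound: "norm (V u) \<le> D u * (\<beta> - \<alpha>)" if "\<bar>u\<bar> \<ge> R" "u \<noteq> Re p" for u
  proof -
    have "norm (V u) \<le> D u * norm (Complex u \<beta> - Complex u \<alpha>)"
    proof (rule has_contour_integral_bound_linepath[OF ver[OF that(2)]])
      show "0 \<le> D u"
        using order_trans[OF norm_ge_zero bound[OF that(1), of \<alpha>]] strip by simp
      show "norm (?G w) \<le> D u" if "w \<in> closed_segment (Complex u \<alpha>) (Complex u \<beta>)" for w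
      proof -
        have "w = Complex u (Im w)" "Im w \<in> {\<alpha>..\<beta>}"
          using that strip by (auto simp: closed_segment_same_Re closed_segment_eq_real_ivl complex_eq_iff)
        then show ?thesis using bound[OF \<open>\<bar>u\<bar> \<ge> R\<close>, of "Im w"] by simp
      qed
    qed
    then show ?thesis using strip by (simp add: cmod_def)
  qed
  have ev: "eventually (\<lambda>n. real n > max \<bar>R\<bar> \<bar>Re p\<bar>) sequentially"
    by (rule filterlim_at_top_dense[THEN iffD1, rule_format, OF filterlim_real_sequentially])
  have V1: "(\<lambda>n. V (real n)) \<longlonglongrightarrow> 0"
  proof (rule Lim_null_comparison)
    show "eventually (\<lambda>n. norm (V (real n)) \<le> D (real n) * (\<beta> - \<alpha>)) sequentially"
      using ev by eventually_elim (rule Vbound; auto)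
    have "(\<lambda>n. D (real n)) \<longlonglongrightarrow> 0"
      by (rule filterlim_compose[OF D(1) filterlim_real_sequentially])
    then show "(\<lambda>n. D (real n) * (\<beta> - \<alpha>)) \<longlonglongrightarrow> 0" by (rule tendsto_mult_left_zero)
  qed
  have V2: "(\<lambda>n. V (- real n)) \<longlonglongrightarrow> 0"
  proof (rule Lim_null_comparison)
    show "eventually (\<lambda>n. norm (V (- real n)) \<le> D (- real n) * (\<beta> - \<alpha>)) sequentially"
      using ev by eventually_elim (rule Vbound; auto)
    have "(\<lambda>n. D (- real n)) \<longlonglongrightarrow> 0"
      using filterlim_compose[OF D(2) filterlim_compose[OF filterlim_uminus_at_bot_at_top filterlim_real_sequentially]]
      by simp
    then show "(\<lambda>n. D (- real n) * (\<beta> - \<alpha>)) \<longlonglongrightarrow> 0" by (rule tendsto_mult_left_zero)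
  qed
  have "(\<lambda>n. I \<alpha> n + V n - I \<beta> n - V (- real n)) \<longlonglongrightarrow>
      (LINT u|lborel. ?G (Complex u \<alpha>)) + 0 - (LINT u|lborel. ?G (Complex u \<beta>)) - 0"
    unfolding I_def by (intro tendsto_intros tendsto_integral_Icc int V1 V2)
  moreover have "eventually (\<lambda>n. I \<alpha> n + V n - I \<beta> n - V (- real n) = 2 * pi * \<i> * F p) sequentially"
    using ev by eventually_elim (rule main, auto)
  then have "(\<lambda>n. I \<alpha> n + V n - I \<beta> n - V (- real n)) \<longlonglongrightarrow> 2 * pi * \<i> * F p"
    by (rule tendsto_eventually)
  ultimately have "(LINT u|lborel. ?G (Complex u \<alpha>)) + 0 - (LINT u|lborel. ?G (Complex u \<beta>)) - 0 = 2 * pi * \<i> * F p"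
    by (rule LIMSEQ_unique)
  then show ?thesis by simp
qed

text \<open>The numerator \<open>f w * (w - p)\<close> vanishes at \<open>p\<close>, so the
  right-hand side of \<open>strip_integral_difference\<close> is 0. The auxiliary point
  \<open>p\<close> is put midway between the two lines.\<close>

corollary strip_integral_eq:
  fixes f :: "complex \<Rightarrow> complex"
  assumes f: "f holomorphic_on {w. A < Im w \<and> Im w < B}"
    and strip: "A < \<alpha>" "\<alpha> < \<beta>" "\<beta> < B"
    and int: "integrable lborel (\<lambda>u. f (Complex u \<alpha>))" "integrable lborel (\<lambda>u. f (Complex u \<beta>))"
    and bound: "\<And>u v. v \<in> {\<alpha>..\<beta>} \<Longrightarrow> norm (f (Complex u v)) \<le> D u"
    and D: "(D \<longlongrightarrow> 0) at_top" "(D \<longlongrightarrow> 0) at_bot"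
  shows "(LINT u|lborel. f (Complex u \<alpha>)) = (LINT u|lborel. f (Complex u \<beta>))"
proof -
  define p where "p = Complex 0 ((\<alpha> + \<beta>) / 2)"
  have G: "f w * (w - p) / (w - p) = f w" if "w \<noteq> p" for w
    using that by simp
  have "\<alpha> < Im p" "Im p < \<beta>" using strip by (simp_all add: p_def)
  then have neq: "Complex u v \<noteq> p" if "v = \<alpha> \<or> v = \<beta> \<or> \<bar>u\<bar> \<ge> 1" for u v
    using that by (auto simp: p_def)
  have "(LINT u|lborel. f (Complex u \<alpha>) * (Complex u \<alpha> - p) / (Complex u \<alpha> - p)) -
      (LINT u|lborel. f (Complex u \<beta>) * (Complex u \<beta> - p) / (Complex u \<beta> - p)) = 2 * pi * \<i> * (f p * (p - p))"
  proof (rule strip_integral_difference[where D = D and R = 1 and A = A and B = B])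
    show "(\<lambda>w. f w * (w - p)) holomorphic_on {w. A < Im w \<and> Im w < B}"
      using f by (intro holomorphic_intros)
    show "norm (f (Complex u v) * (Complex u v - p) / (Complex u v - p)) \<le> D u"
      if "\<bar>u\<bar> \<ge> 1" "v \<in> {\<alpha>..\<beta>}" for u v
      using that bound by (simp add: G neq)
  qed (use strip int D \<open>\<alpha> < Im p\<close> \<open>Im p < \<beta>\<close> in \<open>simp_all add: G neq\<close>)
  then show ?thesis by (simp add: G neq)
qed

section \<open>The line integral of the reduced Wright function\<close>

lemma tendsto_exp_exp:
  fixes a b \<sigma> :: real
  assumes "a > 0" "b > 0" "\<sigma> > 0"
  shows "((\<lambda>u. exp (a * u) * exp (- b * exp (\<sigma> * u))) \<longlongrightarrow> 0) at_top"
    and "((\<lambda>u. exp (a * u) * exp (- b * exp (\<sigma> * u))) \<longlongrightarrow> 0) at_bot"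
  using assms by real_asymp+

lemma Re_exp_Complex: "Re (exp (Complex u v)) = exp u * cos v"
  by (simp add: Re_exp)

lemma cos_le_cos_mono: "\<bar>v\<bar> \<le> t \<Longrightarrow> t \<le> pi \<Longrightarrow> cos t \<le> cos v"
  using cos_monotone_0_pi_le[of "\<bar>v\<bar>" t] by simp

text \<open>With \<open>z = exp w\<close> the form \<open>f w dw\<close> is
  \<open>z powr (a - 1) * exp z dz\<close>, so the line \<open>Im w = \<theta>\<close> is the upper
  ray of Hankel's contour. The lower ray contributes the complex conjugate, hence the imaginary part
  over one line suffices.\<close>

lemma Hankel_integral:
  fixes a \<theta> :: real
  defines "f \<equiv> \<lambda>w. exp (of_real a * w) * exp (exp w)"
  assumes a: "a > 0" and \<theta>: "pi / 2 < \<theta>" "\<theta> < pi"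
  shows "integrable lborel (\<lambda>u. f (Complex u \<theta>))"
    and "Im (LINT u|lborel. f (Complex u \<theta>)) = pi * rGamma (1 - a)"
proof -
  define c where "c = - cos \<theta>"
  have c: "c > 0"
    using cos_monotone_0_pi[of "pi/2" \<theta>] \<theta> by (simp add: c_def)
  define D where "D u = exp (a * u) * exp (- c * exp (1 * u))" for u
  have norm_f: "norm (f (Complex u v)) = exp (a * u) * exp (exp u * cos v)" for u v
    by (simp add: f_def norm_mult Re_exp_Complex)
  \<comment> \<open>The cosine decreases on \<open>{\<theta>..pi}\<close>, so the decay rate
    \<open>c\<close> found at \<open>\<theta>\<close> serves for all lines up to
    \<open>Im w = pi\<close>.\<close>
  have bound: "norm (f (Complex u v)) \<le> D u" if "v \<in> {\<theta>..pi}" for u v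
    using that \<theta> cos_monotone_0_pi_le[of \<theta> v] pi_gt_zero unfolding norm_f D_def c_def
    by (auto simp: mult.commute)
  have intD: "integrable lborel D"
    unfolding D_def by (rule integrable_exp_exp) (use a c in auto)
  have meas: "(\<lambda>u. f (Complex u v)) \<in> borel_measurable lborel" for v
    unfolding f_def Complex_eq by measurable
  have int: "integrable lborel (\<lambda>u. f (Complex u v))" if "v \<in> {\<theta>..pi}" for v
    by (rule Bochner_Integration.integrable_bound[OF intD meas]) (use bound that in \<open>auto intro: order_trans[OF _ abs_ge_self]\<close>)
  then show "integrable lborel (\<lambda>u. f (Complex u \<theta>))"
    using \<theta> by simp
  \<comment> \<open>On \<open>Im w = \<pi>\<close> the integral is Euler's, up to the factor \<open>e\<^bsup>\<i>\<pi>a\<^esup>\<close>; the reflection formula then applies.\<close>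
  have "(LINT u|lborel. f (Complex u \<theta>)) = (LINT u|lborel. f (Complex u pi))"
  proof (rule strip_integral_eq)
    show "f holomorphic_on {w. 0 < Im w \<and> Im w < 4}"
      unfolding f_def by (intro holomorphic_intros)
    show "(D \<longlongrightarrow> 0) at_top" "(D \<longlongrightarrow> 0) at_bot"
      unfolding D_def by (rule tendsto_exp_exp[OF a c zero_less_one])+
  qed (use \<theta> pi_less_4 int bound in auto)
  also have "(\<lambda>u. f (Complex u pi)) = (\<lambda>u. cis (pi * a) * of_real (exp (a * u) * exp (- exp u)))"
  proof
    fix u
    have 1: "exp (Complex u pi) = - of_real (exp u)"
      by (simp add: Complex_eq exp_add exp_of_real flip: cis_conv_exp)
    have 2: "exp (of_real a * Complex u pi) = cis (pi * a) * of_real (exp (a * u))"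
      by (simp add: Complex_eq algebra_simps exp_add cis_conv_exp flip: exp_of_real)
    show "f (Complex u pi) = cis (pi * a) * of_real (exp (a * u) * exp (- exp u))"
      unfolding f_def 1 2 by (simp flip: exp_of_real)
  qed
  also have "(LINT u|lborel. cis (pi * a) * of_real (exp (a * u) * exp (- exp u))) = cis (pi * a) * of_real (Gamma a)"
    using integral_Gamma_exp[OF a] integrable_Gamma_exp[OF a] 
    by (simp only: integral_mult_right_zero integral_complex_of_real)
  finally have "Im (LINT u|lborel. f (Complex u \<theta>)) = sin (pi * a) * Gamma a"
    by simp
  also have "\<dots> = pi * rGamma (1 - a)"
  proof -
    \<comment> \<open>Reflection in terms of \<open>rGamma\<close> also covers integers
      \<open>a\<close>, where \<open>Gamma (1 - a)\<close> has a pole and both sides are 0.\<close>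
    have "rGamma (complex_of_real a) * rGamma (complex_of_real (1 - a)) = sin (complex_of_real (pi * a)) / of_real pi"
      using rGamma_reflection_complex[of "of_real a"] by simp
    then have "complex_of_real (rGamma a * rGamma (1 - a)) = complex_of_real (sin (pi * a) / pi)"
      unfolding rGamma_complex_of_real sin_of_real by simp
    then have "rGamma a * rGamma (1 - a) = sin (pi * a) / pi"
      by (simp only: of_real_eq_iff)
    moreover have "rGamma a = inverse (Gamma a)" "Gamma a \<noteq> 0"
      using less_imp_neq[OF Gamma_real_pos[OF a]] by (auto simp: rGamma_inverse_Gamma)
    ultimately show ?thesis by (simp add: field_simps)
  qed
  finally show "Im (LINT u|lborel. f (Complex u \<theta>)) = pi * rGamma (1 - a)" .
qed

text \<open>As \<open>\<sigma> < 1\<close>, the term \<open>c * exp u\<close> wins to the right of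
  the point where the two exponentials cross; to the left of it, monotonicity gives a constant
  bound.\<close>

lemma exp_power_le_exp:
  fixes y c \<sigma> :: real
  assumes "y > 0" "c > 0" "0 < \<sigma>" "\<sigma> < 1"
  obtains M where "\<And>u. y * exp (\<sigma> * u) \<le> M + c * exp u"
proof
  fix u :: real
  \<comment> \<open>The solution of \<open>y * exp (\<sigma> * u0) = c * exp u0\<close>.\<close>
  define u0 where "u0 = ln (y / c) / (1 - \<sigma>)"
  show "y * exp (\<sigma> * u) \<le> y * exp (\<sigma> * u0) + c * exp u"
  proof (cases "u \<le> u0")
    case True
    then have "y * exp (\<sigma> * u) \<le> y * exp (\<sigma> * u0)" using assms by simp
    also have "\<dots> \<le> y * exp (\<sigma> * u0) + c * exp u" using assms by simp
    finally show ?thesis .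
  next
    case False
    then have "ln (y / c) \<le> (1 - \<sigma>) * u"
      using assms by (simp add: u0_def field_simps)
    then have "exp (ln (y / c)) \<le> exp ((1 - \<sigma>) * u)"
      by simp
    then have "y / c * exp (\<sigma> * u) \<le> exp ((1 - \<sigma>) * u) * exp (\<sigma> * u)"
      using assms by (intro mult_right_mono) auto
    also have "\<dots> = exp u" by (simp add: algebra_simps flip: exp_add)
    finally have "y * exp (\<sigma> * u) \<le> c * exp u" using assms by (simp add: field_simps)
    then show ?thesis using assms by (simp add: add_increasing)
  qed
qed

text \<open>Expanding \<open>exp (- y * exp (\<sigma> * w))\<close> into its power series leaves
  Hankel integrals with parameter \<open>1 + \<sigma> * n\<close>, whose imaginary parts are
  \<open>pi * rGamma (- \<sigma> * n)\<close>.\<close>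

lemma Wright_phi_line_integral:
  fixes y \<sigma> \<theta> :: real
  defines "f \<equiv> \<lambda>w. exp w * exp (exp w - of_real y * exp (of_real \<sigma> * w))"
  assumes y: "y > 0" and \<sigma>: "0 < \<sigma>" "\<sigma> < 1" and \<theta>: "pi / 2 < \<theta>" "\<theta> < pi"
  shows "Wright_phi (- \<sigma>) (- y) = Im (LINT u|lborel. f (Complex u \<theta>)) / pi"
proof -
  define c where "c = - cos \<theta>"
  have c: "c > 0"
    using cos_monotone_0_pi[of "pi/2" \<theta>] \<theta> by (simp add: c_def)
  define K :: "nat \<Rightarrow> complex \<Rightarrow> complex"
    where "K n w = of_real ((- y) ^ n / fact n) * (exp (of_real (1 + \<sigma> * n) * w) * exp (exp w))" for n w
  define D where "D u = exp (y * exp (\<sigma> * u)) * (exp u * exp (- c * exp u))" for u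
  have K_eq: "K n w = (- of_real y * exp (of_real \<sigma> * w)) ^ n /\<^sub>R fact n * (exp w * exp (exp w))" for n w
  proof -
    have "exp (of_real (1 + \<sigma> * n) * w) = exp w * exp (of_real \<sigma> * w) ^ n"
      by (simp add: algebra_simps exp_add flip: exp_of_nat_mult)
    then show ?thesis
      by (simp add: K_def scaleR_conv_of_real divide_simps flip: power_mult_distrib)
  qed
  have K_sums: "(\<lambda>n. K n w) sums f w" for w
  proof -
    have "(\<lambda>n. K n w) sums (exp (- of_real y * exp (of_real \<sigma> * w)) * (exp w * exp (exp w)))"
      unfolding K_eq by (intro sums_mult2 exp_converges)
    also have "exp (- of_real y * exp (of_real \<sigma> * w)) * (exp w * exp (exp w)) = f w"
      by (simp add: f_def exp_diff exp_minus divide_inverse)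
    finally show ?thesis .
  qed
  \<comment> \<open>The series of moduli sums to \<open>exp (y * exp (\<sigma> * u))\<close>. This
    grows, but with \<open>\<sigma> < 1\<close> more slowly than \<open>exp (- c * exp u)\<close>
    decays.\<close>
  have K_bound: "norm (\<Sum>n<N. K n (Complex u \<theta>)) \<le> D u" for N u
  proof -
    have "norm (\<Sum>n<N. K n (Complex u \<theta>)) \<le> (\<Sum>n<N. norm (K n (Complex u \<theta>)))"
      by (rule norm_sum)
    also have "\<dots> = (\<Sum>n<N. (y * exp (\<sigma> * u)) ^ n /\<^sub>R fact n) * (exp u * exp (- c * exp u))"
      using y by (simp add: K_eq norm_mult norm_power Re_exp_Complex c_def sum_distrib_left sum_distrib_right mult_ac)
    also have "\<dots> \<le> exp (y * exp (\<sigma> * u)) * (exp u * exp (- c * exp u))"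
    proof (rule mult_right_mono)
      have "(\<lambda>n. (y * exp (\<sigma> * u)) ^ n /\<^sub>R fact n) sums exp (y * exp (\<sigma> * u))"
        by (rule exp_converges)
      then show "(\<Sum>n<N. (y * exp (\<sigma> * u)) ^ n /\<^sub>R fact n) \<le> exp (y * exp (\<sigma> * u))"
        using y by (metis (mono_tags, lifting) sums_unique sums_summable sum_le_suminf finite_lessThan
              exp_ge_zero fact_ge_zero inverse_nonnegative_iff_nonnegative less_imp_le scaleR_nonneg_nonneg zero_le_mult_iff zero_le_power)
    qed auto
    finally show ?thesis by (simp add: D_def)
  qed
  have intD: "integrable lborel D"
  proof -
    \<comment> \<open>Half of the decay rate \<open>c\<close> absorbs the growth; the other half
      keeps the bound integrable.\<close>
    obtain M where M: "\<And>u. y * exp (\<sigma> * u) \<le> M + c / 2 * exp u"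
      using exp_power_le_exp[of y "c/2" \<sigma>] y c \<sigma> by auto
    have "integrable lborel (\<lambda>u. exp M * (exp (1 * u) * exp (- (c / 2) * exp (1 * u))))"
      using c by (intro integrable_mult_right integrable_exp_exp) auto
    then show ?thesis
    proof (rule Bochner_Integration.integrable_bound)
      show "AE u in lborel. norm (D u) \<le> norm (exp M * (exp (1 * u) * exp (- (c / 2) * exp (1 * u))))"
      proof (rule AE_I2)
        fix u
        have "D u \<le> exp (M + c / 2 * exp u) * (exp u * exp (- c * exp u))"
          unfolding D_def using M[of u] by (intro mult_right_mono) auto
        also have "\<dots> = exp M * (exp (1 * u) * exp (- (c / 2) * exp (1 * u)))"
          by (simp add: algebra_simps flip: exp_add)
        finally show "norm (D u) \<le> norm (exp M * (exp (1 * u) * exp (- (c / 2) * exp (1 * u))))"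
          by (simp add: D_def)
      qed
    qed (simp add: D_def [abs_def])
  qed
  have intK: "integrable lborel (\<lambda>u. K n (Complex u \<theta>))" for n
  proof -
    have pos: "0 < 1 + \<sigma> * real n" using \<sigma> by (simp add: add_pos_nonneg)
    show ?thesis
      unfolding K_def by (intro integrable_mult_right Hankel_integral(1)[OF pos \<theta>])
  qed
  have "(\<lambda>N. LINT u|lborel. (\<Sum>n<N. K n (Complex u \<theta>))) \<longlonglongrightarrow> (LINT u|lborel. f (Complex u \<theta>))"
  proof (rule integral_dominated_convergence[OF _ _ intD])
    show "(\<lambda>u. f (Complex u \<theta>)) \<in> borel_measurable lborel"
      unfolding f_def Complex_eq by measurable
    show "AE u in lborel. (\<lambda>N. \<Sum>n<N. K n (Complex u \<theta>)) \<longlonglongrightarrow> f (Complex u \<theta>)"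
      using K_sums by (simp add: sums_def)
  qed (use K_bound intK in auto)
  then have "(\<lambda>n. LINT u|lborel. K n (Complex u \<theta>)) sums (LINT u|lborel. f (Complex u \<theta>))"
    by (simp add: sums_def intK)
  then have "(\<lambda>n. Im (LINT u|lborel. K n (Complex u \<theta>)) / pi) sums (Im (LINT u|lborel. f (Complex u \<theta>)) / pi)"
    by (intro sums_divide sums_Im)
  also have "(\<lambda>n. Im (LINT u|lborel. K n (Complex u \<theta>)) / pi) = (\<lambda>n. (- y) ^ n / fact n * rGamma (- \<sigma> * real n))"
  proof
    fix n
    have pos: "0 < 1 + \<sigma> * real n" using \<sigma> by (simp add: add_pos_nonneg)
    have Im_scale: "Im (of_real r * z) = r * Im z" for r z by simp
    show "Im (LINT u|lborel. K n (Complex u \<theta>)) / pi = (- y) ^ n / fact n * rGamma (- \<sigma> * real n)"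
      unfolding K_def integral_mult_right_zero Im_scale Hankel_integral(2)[OF pos \<theta>] by simp
  qed
  finally have sums: "(\<lambda>n. (- y) ^ n / fact n * rGamma (- \<sigma> * real n)) sums (Im (LINT u|lborel. f (Complex u \<theta>)) / pi)" .
  \<comment> \<open>The term of index 0 is 0 because \<open>rGamma 0 = 0\<close>, so the sum is
    unchanged when it starts at exponent 1, as in \<open>Wright_phi\<close>.\<close>
  have "(\<lambda>n. (- y) ^ Suc n / fact (Suc n) * rGamma (- \<sigma> * real (Suc n))) sums (Im (LINT u|lborel. f (Complex u \<theta>)) / pi)"
    by (subst sums_Suc_iff) (use sums in simp)
  then show ?thesis
    unfolding Wright_phi_def by (rule sums_unique[symmetric])
qed

section \<open>The Laplace transform\<close>

lemma
  fixes z :: complex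
  assumes z: "Re z > 0"
  shows integrable_exp_minus: "set_integrable lborel {0<..} (\<lambda>t. exp (- z * of_real t))"
    and integral_exp_minus: "(LINT t:{0<..}|lborel. exp (- z * of_real t)) = 1 / z"
    and integral_norm_exp_minus: "(LINT t:{0<..}|lborel. norm (exp (- z * of_real t))) = 1 / Re z"
proof -
  let ?f = "\<lambda>t. exp (- z * of_real t)"
  have r: "((\<lambda>t. exp (- Re z * t)) has_integral 1 / Re z) {0<..}"
  proof -
    have "((\<lambda>t. exp (- Re z * t)) has_integral 1 / Re z) {0..}"
      using has_integral_exp_minus_to_infinity[OF z, of 0] by simp
    then have "((\<lambda>t. if t \<in> {0<..} then exp (- Re z * t) else 0) has_integral 1 / Re z) {0..}"
      by (rule has_integral_spike[of "{0}", rotated 2]) auto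
    then show ?thesis
      by (subst (asm) has_integral_restrict) auto
  qed
  then have ai: "(\<lambda>t. exp (- Re z * t)) absolutely_integrable_on {0<..}"
    by (intro nonnegative_absolutely_integrable_1) (auto simp: integrable_on_def)
  then have int: "set_integrable lborel {0<..} (\<lambda>t. exp (- Re z * t))"
    unfolding set_integrable_def by (subst (asm) integrable_completion) auto
  have norm_f: "norm (?f t) = exp (- Re z * t)" for t by simp
  show int_f: "set_integrable lborel {0<..} ?f"
    using int unfolding set_integrable_def
    by (rule Bochner_Integration.integrable_bound) (auto simp: norm_f)
  show "(LINT t:{0<..}|lborel. norm (?f t)) = 1 / Re z"
    unfolding norm_f using set_borel_integral_eq_integral(2)[OF int] integral_unique[OF r] by simp
  have "z \<noteq> 0" using z by auto
  have e0: "einterval 0 \<infinity> = {0<..}"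
    by (auto simp: einterval_def zero_ereal_def)
  have "(LBINT t=0..\<infinity>. ?f t) = 0 - (- 1 / z)"
  proof (rule interval_integral_FTC_integrable)
    show "((\<lambda>t. - ?f t / z) has_vector_derivative ?f t) (at t)" for t
    proof -
      have "((\<lambda>w. - exp (- z * w) / z) has_field_derivative ?f t) (at (of_real t))"
        using \<open>z \<noteq> 0\<close> by (auto intro!: derivative_eq_intros)
      then show ?thesis
        by (rule has_vector_derivative_real_field)
    qed
    show "set_integrable lborel (einterval 0 \<infinity>) ?f"
      using int_f by (simp add: e0)
    show "(((\<lambda>t. - ?f t / z) \<circ> real_of_ereal) \<longlongrightarrow> - 1 / z) (at_right 0)"
      unfolding zero_ereal_def ereal_tendsto_simps using \<open>z \<noteq> 0\<close> by (auto intro!: tendsto_eq_intros)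
    show "(((\<lambda>t. - ?f t / z) \<circ> real_of_ereal) \<longlongrightarrow> 0) (at_left \<infinity>)"
      unfolding ereal_tendsto_simps
    proof (rule tendsto_norm_zero_cancel)
      show "((\<lambda>t. norm (- ?f t / z)) \<longlongrightarrow> 0) at_top"
        unfolding norm_divide norm_minus_cancel norm_f using z \<open>z \<noteq> 0\<close> by real_asymp
    qed
  qed (auto intro!: continuous_intros)
  then show "(LINT t:{0<..}|lborel. ?f t) = 1 / z"
    by (simp add: interval_lebesgue_integral_def e0)
qed

text \<open>Translating the line by \<open>ln t\<close> multiplies \<open>exp w\<close> by
  \<open>t\<close> and \<open>exp (\<sigma> * w)\<close> by \<open>t powr \<sigma>\<close>, which
  cancels \<open>t powr (- \<sigma>)\<close>. Divided by \<open>t\<close>, this is a density of the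
  one-sided stable law of index \<open>\<sigma>\<close>.\<close>

lemma Wright_phi_stable_density:
  fixes x \<sigma> \<theta> t :: real
  assumes x: "x > 0" and \<sigma>: "0 < \<sigma>" "\<sigma> < 1" and \<theta>: "pi / 2 < \<theta>" "\<theta> < pi" and t: "t > 0"
  shows "Wright_phi (- \<sigma>) (- x * t powr (- \<sigma>)) =
    t * Im (LINT u|lborel. exp (Complex u \<theta>) *
        exp (of_real t * exp (Complex u \<theta>) - of_real x * exp (of_real \<sigma> * Complex u \<theta>))) / pi"
proof -
  define y where "y = x * t powr (- \<sigma>)"
  have y: "y > 0" using x t by (simp add: y_def)
  have 1: "exp (Complex (ln t + u) \<theta>) = of_real t * exp (Complex u \<theta>)" for u
    using t by (simp add: Complex_eq exp_add exp_of_real)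
  have 2: "of_real y * exp (of_real \<sigma> * Complex (ln t + u) \<theta>) = of_real x * exp (of_real \<sigma> * Complex u \<theta>)" for u
  proof -
    have "exp (of_real \<sigma> * Complex (ln t + u) \<theta>) = of_real (t powr \<sigma>) * exp (of_real \<sigma> * Complex u \<theta>)"
      using t by (simp add: Complex_eq powr_def algebra_simps flip: exp_of_real exp_add)
    moreover have "y * t powr \<sigma> = x"
      using t by (simp add: y_def powr_minus)
    ultimately show ?thesis
      by (metis mult.assoc of_real_mult)
  qed
  have "Wright_phi (- \<sigma>) (- y) = Im (LINT u|lborel. exp (Complex u \<theta>) *
      exp (exp (Complex u \<theta>) - of_real y * exp (of_real \<sigma> * Complex u \<theta>))) / pi"
    by (rule Wright_phi_line_integral[OF y \<sigma> \<theta>])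
  also have "(LINT u|lborel. exp (Complex u \<theta>) *
      exp (exp (Complex u \<theta>) - of_real y * exp (of_real \<sigma> * Complex u \<theta>))) =
      (LINT u|lborel. exp (Complex (ln t + u) \<theta>) *
      exp (exp (Complex (ln t + u) \<theta>) - of_real y * exp (of_real \<sigma> * Complex (ln t + u) \<theta>)))"
    using lborel_integral_real_affine[of 1 "\<lambda>u. exp (Complex u \<theta>) *
      exp (exp (Complex u \<theta>) - of_real y * exp (of_real \<sigma> * Complex u \<theta>))" "ln t"] by simp
  also have "\<dots> = of_real t * (LINT u|lborel. exp (Complex u \<theta>) *
        exp (of_real t * exp (Complex u \<theta>) - of_real x * exp (of_real \<sigma> * Complex u \<theta>)))"
    unfolding 1 2 by (simp add: mult.assoc)
  finally show ?thesis by (simp add: y_def)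
qed

text \<open>The quotient is what the Laplace kernel \<open>exp (- (q - exp w) * t)\<close> leaves
  after integration over \<open>t\<close>. Its only pole near the real axis is \<open>ln q\<close>;
  Cauchy's formula between the conjugate lines \<open>Im w = - \<theta>\<close> and
  \<open>Im w = \<theta>\<close> yields the imaginary part.\<close>

lemma
  fixes x \<sigma> \<theta> q :: real
  defines "g \<equiv> \<lambda>w. exp w * exp (- of_real x * exp (of_real \<sigma> * w))"
  assumes x: "x > 0" and \<sigma>: "0 < \<sigma>" "\<sigma> < 1" and \<theta>: "pi / 2 < \<theta>" "\<theta> < pi" "\<sigma> * \<theta> < pi / 2" and q: "q > 0"
  shows integrable_resolvent: "integrable lborel (\<lambda>u. g (Complex u \<theta>) / (of_real q - exp (Complex u \<theta>)))"
    and Im_integral_resolvent: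
      "Im (LINT u|lborel. g (Complex u \<theta>) / (of_real q - exp (Complex u \<theta>))) = pi * exp (- x * q powr \<sigma>)"
    and norm_resolvent: "norm (g (Complex u \<theta>)) \<le> exp (1 * u) * exp (- (x * cos (\<sigma> * \<theta>)) * exp (\<sigma> * u))"
proof -
  define d where "d = x * cos (\<sigma> * \<theta>)"
  have d: "d > 0"
  proof -
    have "\<sigma> * \<theta> > 0" using \<sigma> \<theta> pi_gt_zero by simp
    then have "cos (\<sigma> * \<theta>) > 0" using \<theta> by (intro cos_gt_zero_pi) auto
    then show ?thesis using x by (simp add: d_def)
  qed
  define p where "p = complex_of_real (ln q)"
  have exp_p: "exp p = of_real q" using q by (simp add: p_def exp_of_real)
  \<comment> \<open>The half-width 4 lies between \<open>pi\<close> and \<open>2 * pi\<close>: both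
    lines fit inside the strip, and \<open>p\<close> is the only solution of
    \<open>exp w = q\<close> in it.\<close>
  define S where "S = {w::complex. -4 < Im w \<and> Im w < 4}"
  \<comment> \<open>\<open>F\<close> continues \<open>g w (w - p) / (q - e\<^sup>w)\<close> over its removable singularity at \<open>p\<close>.\<close>
  define E where "E w = (if w = p then deriv exp p else (exp w - exp p) / (w - p))" for w :: complex
  define F where "F w = - g w / E w" for w
  let ?G = "\<lambda>w. g w / (of_real q - exp w)"
  have E_p: "E p = of_real q" by (simp add: E_def exp_p DERIV_imp_deriv[OF DERIV_exp])
  have exp_inj: "w = p" if ew: "exp w = exp p" "w \<in> S" for w
  proof -
    obtain n :: int where n: "w = p + (of_int (2 * n) * pi) * \<i>"
      using ew(1) exp_eq[of w p] by auto
    then have "Im w = 2 * pi * n" by (simp add: p_def)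
    then have "\<bar>2 * pi * real_of_int n\<bar> < 4" using that(2) by (auto simp: S_def)
    moreover have "2 * pi > 4" using pi_gt3 by simp
    ultimately have "(2 * pi) * \<bar>real_of_int n\<bar> < (2 * pi) * 1" by (simp only: abs_mult)
    then have "\<bar>real_of_int n\<bar> < 1" by (rule mult_left_less_imp_less) simp
    then have "n = 0" by linarith
    with n show ?thesis by simp
  qed
  have E_nz: "E w \<noteq> 0" if "w \<in> S" for w
  proof (cases "w = p")
    case True
    then show ?thesis using q by (simp add: E_p)
  next
    case False
    then show ?thesis using exp_inj[OF _ that] by (auto simp: E_def)
  qed
  have "open S"
    unfolding S_def using open_Int[OF open_halfspace_Im_gt[of "-4"] open_halfspace_Im_lt[of 4]]
    by (simp add: Int_def)
  then have E_holo: "E holomorphic_on S"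
    unfolding E_def by (intro pole_lemma_open holomorphic_intros)
  have F_holo: "F holomorphic_on S"
    unfolding F_def g_def using E_nz by (intro holomorphic_intros E_holo) auto
  have F_eq: "F w / (w - p) = ?G w" if "w \<noteq> p" for w
  proof -
    have "F w = - g w / ((exp w - exp p) / (w - p))"
      using that by (simp add: F_def E_def)
    then have "F w / (w - p) = - g w / (exp w - exp p)"
      using that by simp
    also have "\<dots> = g w / (exp p - exp w)"
      using minus_divide_divide[of "g w" "exp p - exp w"] by (simp only: minus_diff_eq)
    finally show ?thesis by (simp only: exp_p)
  qed
  have F_p: "F p = - of_real (exp (- x * q powr \<sigma>))"
  proof -
    have "exp (of_real \<sigma> * p) = of_real (q powr \<sigma>)"
      using q by (simp add: p_def powr_def flip: exp_of_real)
    then have "g p = of_real q * of_real (exp (- x * q powr \<sigma>))"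
      by (simp add: g_def exp_p flip: exp_of_real)
    then show ?thesis using q by (simp add: F_def E_p)
  qed
  \<comment> \<open>Here \<open>\<sigma> * \<theta> < pi / 2\<close> matters:
    \<open>cos (\<sigma> * v)\<close> stays above the positive number
    \<open>cos (\<sigma> * \<theta>)\<close> throughout the strip.\<close>
  have norm_g: "norm (g (Complex u v)) \<le> exp (1 * u) * exp (- d * exp (\<sigma> * u))" if "\<bar>v\<bar> \<le> \<theta>" for u v
  proof -
    have "norm (g (Complex u v)) = exp u * exp (- x * (exp (\<sigma> * u) * cos (\<sigma> * v)))"
      by (simp add: g_def norm_mult Re_exp)
    moreover have "cos (\<sigma> * \<theta>) \<le> cos (\<sigma> * v)"
      using that \<sigma> \<theta> pi_gt_zero by (intro cos_le_cos_mono) (auto simp: abs_mult)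
    then have "- x * (exp (\<sigma> * u) * cos (\<sigma> * v)) \<le> - d * exp (\<sigma> * u)"
      using x by (simp add: d_def)
    ultimately show ?thesis by simp
  qed
  then show "norm (g (Complex u \<theta>)) \<le> exp (1 * u) * exp (- (x * cos (\<sigma> * \<theta>)) * exp (\<sigma> * u))"
    using \<theta> pi_gt_zero by (simp add: d_def)
  have cos_neg: "cos \<theta> < 0" using cos_monotone_0_pi[of "pi/2" \<theta>] \<theta> by simp
  \<comment> \<open>On both lines \<open>exp w\<close> has negative real part, so the denominator
    has modulus at least \<open>q\<close>.\<close>
  have int: "integrable lborel (\<lambda>u. ?G (Complex u v))" if "v = \<theta> \<or> v = - \<theta>" for v
  proof (rule Bochner_Integration.integrable_bound)
    show "integrable lborel (\<lambda>u. exp (1 * u) * exp (- d * exp (\<sigma> * u)) / q)"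
      using d \<sigma> by (intro integrable_divide integrable_exp_exp) auto
    show "AE u in lborel. norm (?G (Complex u v)) \<le> norm (exp (1 * u) * exp (- d * exp (\<sigma> * u)) / q)"
    proof (rule AE_I2)
      fix u
      have "q \<le> Re (of_real q - exp (Complex u v))"
        using that cos_neg by (auto simp: Re_exp_Complex mult_le_0_iff)
      also have "\<dots> \<le> norm (of_real q - exp (Complex u v))" by (rule complex_Re_le_cmod)
      finally have "q \<le> norm (of_real q - exp (Complex u v))" .
      then show "norm (?G (Complex u v)) \<le> norm (exp (1 * u) * exp (- d * exp (\<sigma> * u)) / q)"
        using norm_g[of v u] that q \<theta> pi_gt_zero
        by (auto simp: norm_divide norm_mult intro!: frac_le)
    qed
    show "(\<lambda>u. ?G (Complex u v)) \<in> borel_measurable lborel"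
      unfolding g_def Complex_eq by measurable
  qed
  show "integrable lborel (\<lambda>u. ?G (Complex u \<theta>))" by (rule int) simp
  \<comment> \<open>Between the lines \<open>exp w\<close> may come close to \<open>q\<close>; there
    only the reverse triangle inequality is available, which is useful for \<open>u\<close> away
    from \<open>ln q\<close>.\<close>
  define D where "D u = exp (1 * u) * exp (- d * exp (\<sigma> * u)) / \<bar>exp u - q\<bar>" for u
  have neq: "Complex u v \<noteq> p" if "v = \<theta> \<or> v = - \<theta> \<or> \<bar>u\<bar> \<ge> \<bar>ln q\<bar> + 1" for u v
    using that \<theta> pi_gt_zero by (auto simp: p_def complex_eq_iff)
  have "(LINT u|lborel. F (Complex u (- \<theta>)) / (Complex u (- \<theta>) - p)) -
      (LINT u|lborel. F (Complex u \<theta>) / (Complex u \<theta> - p)) = 2 * pi * \<i> * F p"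
  proof (rule strip_integral_difference[where D = D and R = "\<bar>ln q\<bar> + 1" and A = "-4" and B = 4])
    show "F holomorphic_on {w. -4 < Im w \<and> Im w < 4}" using F_holo by (simp add: S_def)
    show "norm (F (Complex u v) / (Complex u v - p)) \<le> D u"
      if uv: "\<bar>u\<bar> \<ge> \<bar>ln q\<bar> + 1" "v \<in> {- \<theta>..\<theta>}" for u v
    proof -
      have "u \<noteq> ln q" using uv by auto
      then have "exp u \<noteq> q" by auto
      moreover have "\<bar>exp u - q\<bar> \<le> norm (of_real q - exp (Complex u v))"
        using norm_triangle_ineq3[of "of_real q" "exp (Complex u v)"] q by (simp add: abs_minus_commute)
      ultimately show ?thesis
        using norm_g[of v u] uv neq[of v u] unfolding F_eq[OF neq[OF disjI2[OF disjI2[OF uv(1)]]]] D_def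
        by (auto simp: norm_divide intro!: frac_le)
    qed
    show "(D \<longlongrightarrow> 0) at_top" "(D \<longlongrightarrow> 0) at_bot"
      unfolding D_def using d \<sigma> q by real_asymp+
    show "- 4 < - \<theta>" "- \<theta> < Im p" "Im p < \<theta>" "\<theta> < 4"
      using \<theta> pi_gt_zero pi_less_4 by (auto simp: p_def)
  qed (use int F_eq neq in auto)
  then have diff: "(LINT u|lborel. ?G (Complex u (- \<theta>))) - (LINT u|lborel. ?G (Complex u \<theta>)) = 2 * pi * \<i> * F p"
    by (simp add: F_eq neq)
  \<comment> \<open>All constants in \<open>?G\<close> are real. Hence the two line integrals are
    conjugate, and their difference is \<open>- 2 * \<i>\<close> times the imaginary part of the
    upper one.\<close>
  have "?G (Complex u (- \<theta>)) = cnj (?G (Complex u \<theta>))" for u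
  proof -
    have "Complex u (- \<theta>) = cnj (Complex u \<theta>)" by (simp add: complex_eq_iff)
    then show ?thesis unfolding g_def by (simp add: exp_cnj)
  qed
  then have "(LINT u|lborel. ?G (Complex u (- \<theta>))) = cnj (LINT u|lborel. ?G (Complex u \<theta>))"
    by (simp only: Bochner_Integration.integral_cnj)
  with diff have "Im (cnj (LINT u|lborel. ?G (Complex u \<theta>)) - (LINT u|lborel. ?G (Complex u \<theta>))) = Im (2 * pi * \<i> * F p)"
    by simp
  then show "Im (LINT u|lborel. ?G (Complex u \<theta>)) = pi * exp (- x * q powr \<sigma>)"
    by (simp add: F_p)
qed

text \<open>Fubini for \<open>H\<close>: integrating over \<open>u\<close> first gives the Laplace
  integrand, after taking \<open>Im\<close> and dividing by \<open>pi\<close>; integrating over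
  \<open>t\<close> first gives the resolvent integral.\<close>

lemma
  fixes x \<sigma> q :: real
  assumes x: "x > 0" and \<sigma>: "0 < \<sigma>" "\<sigma> < 1" and q: "q > 0"
  shows integrable_laplace_Wright_phi:
      "set_integrable lborel {0<..} (\<lambda>t. exp (- q * t) * (Wright_phi (- \<sigma>) (- x * t powr (- \<sigma>)) / t))"
    and integral_laplace_Wright_phi:
      "(LINT t:{0<..}|lborel. exp (- q * t) * (Wright_phi (- \<sigma>) (- x * t powr (- \<sigma>)) / t)) = exp (- x * q powr \<sigma>)"
proof -
  \<comment> \<open>\<open>\<sigma> < 1\<close> is what leaves room for an angle with both
    \<open>cos \<theta> < 0\<close> and \<open>cos (\<sigma> * \<theta>) > 0\<close>.\<close>
  have "pi / 2 < min pi (pi / (2 * \<sigma>))"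
    using \<sigma> pi_gt_zero by (simp add: field_simps)
  then obtain \<theta> where "pi / 2 < \<theta>" "\<theta> < min pi (pi / (2 * \<sigma>))"
    using dense by blast
  then have \<theta>: "pi / 2 < \<theta>" "\<theta> < pi" "\<sigma> * \<theta> < pi / 2"
    using \<sigma> by (auto simp: field_simps)
  define d where "d = x * cos (\<sigma> * \<theta>)"
  have d: "d > 0"
  proof -
    have "\<sigma> * \<theta> > 0" using \<sigma> \<theta> pi_gt_zero by simp
    then have "cos (\<sigma> * \<theta>) > 0" using \<theta> by (intro cos_gt_zero_pi) auto
    then show ?thesis using x by (simp add: d_def)
  qed
  have cos_neg: "cos \<theta> < 0" using cos_monotone_0_pi[of "pi/2" \<theta>] \<theta> by simp
  define g where "g w = exp w * exp (- of_real x * exp (of_real \<sigma> * w))" for w :: complex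
  define w where "w u = Complex u \<theta>" for u
  define H where "H u t = indicat_real {0<..} t *\<^sub>R (g (w u) * exp (- (of_real q - exp (w u)) * of_real t))" for u t
  have norm_g: "norm (g (w u)) \<le> exp (1 * u) * exp (- d * exp (\<sigma> * u))" for u
    using norm_resolvent[OF x \<sigma> \<theta> q] by (simp add: g_def w_def d_def)
  have q_le: "q \<le> Re (of_real q - exp (w u))" for u
    using cos_neg by (simp add: w_def Re_exp_Complex mult_le_0_iff)
  then have Re_pos: "0 < Re (of_real q - exp (w u))" for u
    using q less_le_trans by blast
  have H_int: "integrable lborel (H u)" for u
    using set_integrable_mult_right[where a = "g (w u)", OF integrable_exp_minus[OF Re_pos[of u]]]
    unfolding H_def set_integrable_def by simp
  have H_integral: "(LINT t|lborel. H u t) = g (w u) / (of_real q - exp (w u))" for u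
  proof -
    have "(LINT t|lborel. H u t) =
        (LINT t:{0<..}|lborel. g (w u) * exp (- (of_real q - exp (w u)) * of_real t))"
      unfolding H_def set_lebesgue_integral_def ..
    then show ?thesis
      unfolding set_integral_mult_right integral_exp_minus[OF Re_pos[of u]] by simp
  qed
  have H_norm: "(LINT t|lborel. norm (H u t)) = norm (g (w u)) / Re (of_real q - exp (w u))" for u
  proof -
    have "(LINT t|lborel. norm (H u t)) =
        (LINT t:{0<..}|lborel. norm (g (w u)) * norm (exp (- (of_real q - exp (w u)) * of_real t)))"
      unfolding H_def set_lebesgue_integral_def
      by (intro Bochner_Integration.integral_cong) (auto simp: norm_mult indicator_def)
    then show ?thesis
      unfolding set_integral_mult_right integral_norm_exp_minus[OF Re_pos[of u]] by simp
  qed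
  have meas [measurable]: "(\<lambda>(u, t). H u t) \<in> borel_measurable (lborel \<Otimes>\<^sub>M lborel)"
    unfolding H_def g_def w_def Complex_eq by measurable
  have int2: "integrable (lborel \<Otimes>\<^sub>M lborel) (\<lambda>(u, t). H u t)"
  \<comment> \<open>The \<open>t\<close>-integral of the norm is
    \<open>norm (g (w u)) / Re (q - exp (w u))\<close>; its denominator is at least
    \<open>q\<close>, and the numerator is integrable by \<open>norm_g\<close>.\<close>
  proof (rule lborel_pair.Fubini_integrable)
    have "integrable lborel (\<lambda>u. exp (1 * u) * exp (- d * exp (\<sigma> * u)) / q)"
      using d \<sigma> by (intro integrable_divide integrable_exp_exp) auto
    then have "integrable lborel (\<lambda>u. norm (g (w u)) / Re (of_real q - exp (w u)))"
    proof (rule Bochner_Integration.integrable_bound)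
      show "(\<lambda>u. norm (g (w u)) / Re (of_real q - exp (w u))) \<in> borel_measurable lborel"
        unfolding g_def w_def Complex_eq by measurable
      show "AE u in lborel. norm (norm (g (w u)) / Re (of_real q - exp (w u)))
          \<le> norm (exp (1 * u) * exp (- d * exp (\<sigma> * u)) / q)"
      proof (rule AE_I2)
        fix u
        have "norm (g (w u)) / Re (of_real q - exp (w u)) \<le> exp (1 * u) * exp (- d * exp (\<sigma> * u)) / q"
          using norm_g q_le q by (intro frac_le) auto
        moreover have "0 \<le> norm (g (w u)) / Re (of_real q - exp (w u))"
          using Re_pos[of u] by (intro divide_nonneg_pos) auto
        ultimately show "norm (norm (g (w u)) / Re (of_real q - exp (w u)))
          \<le> norm (exp (1 * u) * exp (- d * exp (\<sigma> * u)) / q)"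
          by (metis abs_ge_self abs_of_nonneg order_trans real_norm_def)
      qed
    qed
    then show "integrable lborel (\<lambda>u. LINT t|lborel. norm (case (u, t) of (u, t) \<Rightarrow> H u t))"
      by (simp add: H_norm)
    show "AE u in lborel. integrable lborel (\<lambda>t. case (u, t) of (u, t) \<Rightarrow> H u t)"
      using H_int by simp
  qed (rule meas)
  have inner: "Im (LINT u|lborel. H u t) / pi =
      indicat_real {0<..} t *\<^sub>R (exp (- q * t) * (Wright_phi (- \<sigma>) (- x * t powr (- \<sigma>)) / t))" for t
  proof (cases "t > 0")
    case True
    have "(LINT u|lborel. H u t) = (LINT u|lborel. of_real (exp (- q * t)) *
        (exp (w u) * exp (of_real t * exp (w u) - of_real x * exp (of_real \<sigma> * w u))))"
    proof (intro Bochner_Integration.integral_cong refl)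
      fix u
      have "exp (- (of_real q - exp (w u)) * of_real t) * exp (- of_real x * exp (of_real \<sigma> * w u))
        = of_real (exp (- q * t)) * exp (of_real t * exp (w u) - of_real x * exp (of_real \<sigma> * w u))"
        by (simp add: algebra_simps flip: exp_of_real exp_add)
      then show "H u t = of_real (exp (- q * t)) *
        (exp (w u) * exp (of_real t * exp (w u) - of_real x * exp (of_real \<sigma> * w u)))"
        using True by (simp add: H_def g_def mult_ac)
    qed
    also have "\<dots> = of_real (exp (- q * t)) * (LINT u|lborel.
        exp (w u) * exp (of_real t * exp (w u) - of_real x * exp (of_real \<sigma> * w u)))"
      by (rule integral_mult_right_zero)
    finally have "Im (LINT u|lborel. H u t) / pi = exp (- q * t) * (Im (LINT u|lborel.
        exp (w u) * exp (of_real t * exp (w u) - of_real x * exp (of_real \<sigma> * w u))) / pi)"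
      by simp
    then show ?thesis
      using True Wright_phi_stable_density[OF x \<sigma> \<theta>(1,2) True] by (simp add: w_def)
  next
    case False
    then show ?thesis by (simp add: H_def)
  qed
  have int3: "integrable lborel (\<lambda>t. LINT u|lborel. H u t)"
    by (rule lborel_pair.integrable_snd[OF int2])
  have "integrable lborel (\<lambda>t. Im (LINT u|lborel. H u t) / pi)"
    by (intro integrable_divide integrable_Im int3)
  then show "set_integrable lborel {0<..} (\<lambda>t. exp (- q * t) * (Wright_phi (- \<sigma>) (- x * t powr (- \<sigma>)) / t))"
    unfolding inner set_integrable_def .
  have "(LINT t|lborel. LINT u|lborel. H u t) = (LINT u|lborel. LINT t|lborel. H u t)"
    by (rule lborel_pair.Fubini_integral[OF int2])
  then have "Im (LINT t|lborel. LINT u|lborel. H u t) = pi * exp (- x * q powr \<sigma>)"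
    unfolding H_integral using Im_integral_resolvent[OF x \<sigma> \<theta> q] by (simp add: g_def w_def)
  moreover have "(LINT t|lborel. Im (LINT u|lborel. H u t) / pi) = Im (LINT t|lborel. LINT u|lborel. H u t) / pi"
    using int3 by simp
  ultimately show "(LINT t:{0<..}|lborel. exp (- q * t) * (Wright_phi (- \<sigma>) (- x * t powr (- \<sigma>)) / t)) = exp (- x * q powr \<sigma>)"
    unfolding inner set_lebesgue_integral_def by simp
qed

section \<open>Moments\<close>

lemma power_le_fact_mult_exp:
  fixes y :: real
  assumes "y \<ge> 0"
  shows "y ^ k \<le> fact k * exp y"
proof -
  have s: "(\<lambda>n. y ^ n /\<^sub>R fact n) sums exp y" by (rule exp_converges)
  have "(\<Sum>n\<in>{k}. y ^ n /\<^sub>R fact n) \<le> exp y"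
    unfolding sums_unique[OF s] using assms by (intro sum_le_suminf sums_summable[OF s]) auto
  then show ?thesis by (simp add: field_simps)
qed

text \<open>The difference series sums to 0 near the origin, whereas a nonzero coefficient would
  force nonzero values in a punctured neighbourhood.\<close>

lemma power_series_unique:
  fixes a b :: "nat \<Rightarrow> real"
  assumes r: "r > 0"
    and a: "\<And>z. \<bar>z\<bar> < r \<Longrightarrow> (\<lambda>n. a n * z ^ n) sums f z"
    and b: "\<And>z. \<bar>z\<bar> < r \<Longrightarrow> (\<lambda>n. b n * z ^ n) sums f z"
  shows "a = b"
proof (rule ccontr)
  assume "a \<noteq> b"
  then obtain m where m: "a m - b m \<noteq> 0" by auto
  have sums: "(\<lambda>n. (a n - b n) * z ^ n) sums 0" if "\<bar>z\<bar> < r" for z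
    using sums_diff[OF a[of z] b[of z]] that by (simp add: left_diff_distrib)
  have "a 0 - b 0 = 0"
    using sums_unique2[OF sums[of 0] powser_sums_zero[of "\<lambda>n. a n - b n"]] r by simp
  \<comment> \<open>\<open>powser_0_nonzero\<close> asks for a nonzero coefficient of positive
    index; the constant one has just been excluded by evaluating at 0.\<close>
  with m have "m > 0" by (intro gr0I) auto
  obtain s where s: "s > 0" "\<And>z::real. z \<in> cball 0 s - {0} \<Longrightarrow> (\<lambda>_. 0 :: real) z \<noteq> 0"
    by (rule powser_0_nonzero[of r 0 "\<lambda>n. a n - b n" "\<lambda>_. 0" m]) (use r m \<open>m > 0\<close> sums in auto)
  then show False using s(1) s(2)[of s] by auto
qed

text \<open>Expanding \<open>exp (z * t)\<close> in the Laplace integrand at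
  \<open>q = 1 - z\<close> makes its transform the exponential generating function of the
  moments.\<close>

lemma
  fixes x \<sigma> :: real
  defines "P \<equiv> \<lambda>t. Wright_phi (- \<sigma>) (- x * t powr (- \<sigma>)) / t"
  assumes x: "x > 0" and \<sigma>: "0 < \<sigma>" "\<sigma> < 1"
  shows integrable_moment_Wright_phi: "set_integrable lborel {0<..} (\<lambda>t. exp (- t) * t ^ k * P t)"
    and moments_Wright_phi_sums: "\<bar>z\<bar> < 1 \<Longrightarrow>
      (\<lambda>k. (LINT t:{0<..}|lborel. exp (- t) * t ^ k * P t) / fact k * z ^ k) sums exp (- x * (1 - z) powr \<sigma>)"
proof -
  have int: "integrable lborel (\<lambda>t. indicat_real {0<..} t * (exp (- q * t) * P t))" if "q > 0" for q
    using integrable_laplace_Wright_phi[OF x \<sigma> that] by (simp add: set_integrable_def P_def)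
  have meas: "(\<lambda>t. indicat_real {0<..} t * (exp (- t) * t ^ k * P t)) \<in> borel_measurable lborel" for k
  proof -
    \<comment> \<open>Measurability is inherited from the integrable Laplace integrand at
      \<open>q = 1\<close>, multiplied by continuous functions.\<close>
    have "(\<lambda>t. exp (- t) * t ^ k * exp t * (indicat_real {0<..} t * (exp (- 1 * t) * P t))) \<in> borel_measurable lborel"
      by (intro borel_measurable_times borel_measurable_integrable[OF int]) auto
    also have "(\<lambda>t. exp (- t) * t ^ k * exp t * (indicat_real {0<..} t * (exp (- 1 * t) * P t)))
       = (\<lambda>t. indicat_real {0<..} t * (exp (- t) * t ^ k * P t))"
      by (auto simp: fun_eq_iff exp_minus)
    finally show ?thesis .
  qed
  have moment: "integrable lborel (\<lambda>t. indicat_real {0<..} t * (exp (- t) * t ^ k * P t))" for k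
  proof (rule Bochner_Integration.integrable_bound[OF _ meas])
    \<comment> \<open>Splitting \<open>exp (- t)\<close> into two halves, one absorbs
      \<open>t ^ k\<close> at the cost \<open>fact k * 2 ^ k\<close>, and the other is the Laplace
      kernel at \<open>q = 1 / 2\<close>.\<close>
    show "integrable lborel (\<lambda>t. fact k * 2 ^ k * (indicat_real {0<..} t * (exp (- (1 / 2) * t) * P t)))"
      by (intro integrable_mult_right int) auto
    show "AE t in lborel. norm (indicat_real {0<..} t * (exp (- t) * t ^ k * P t))
      \<le> norm (fact k * 2 ^ k * (indicat_real {0<..} t * (exp (- (1 / 2) * t) * P t)))"
    proof (rule AE_I2)
      fix t :: real
      show "norm (indicat_real {0<..} t * (exp (- t) * t ^ k * P t))
        \<le> norm (fact k * 2 ^ k * (indicat_real {0<..} t * (exp (- (1 / 2) * t) * P t)))"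
      proof (cases "t > 0")
        case True
        have "(t / 2) ^ k \<le> fact k * exp (t / 2)"
          using True by (intro power_le_fact_mult_exp) auto
        then have "t ^ k \<le> fact k * 2 ^ k * exp (t / 2)"
          by (simp add: field_simps)
        then have "exp (- t) * t ^ k \<le> exp (- t) * (fact k * 2 ^ k * exp (t / 2))"
          by simp
        also have "\<dots> = fact k * 2 ^ k * exp (- (1 / 2) * t)"
          by (simp add: field_simps flip: exp_add)
        finally have "exp (- t) * t ^ k * \<bar>P t\<bar> \<le> fact k * 2 ^ k * exp (- (1 / 2) * t) * \<bar>P t\<bar>"
          by (rule mult_right_mono) simp
        then show ?thesis using True by (simp add: abs_mult mult_ac)
      qed simp
    qed
  qed
  then show "set_integrable lborel {0<..} (\<lambda>t. exp (- t) * t ^ k * P t)"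
    by (simp add: set_integrable_def)
  assume z: "\<bar>z\<bar> < 1"
  let ?f = "\<lambda>k t. z ^ k / fact k * (indicat_real {0<..} t * (exp (- t) * t ^ k * P t))"
  let ?g = "\<lambda>t. indicat_real {0<..} t * (exp (- (1 - z) * t) * P t)"
  have exp_sums: "(\<lambda>k. (y * t) ^ k / fact k) sums exp (y * t)" for y t :: real
    using exp_converges[of "y * t"] by (simp add: divide_inverse mult.commute)
  have f_eq: "?f k t = (z * t) ^ k / fact k * (indicat_real {0<..} t * (exp (- t) * P t))" for k t
    by (simp add: power_mult_distrib)
  have "(\<lambda>N. LINT t|lborel. (\<Sum>k<N. ?f k t)) \<longlonglongrightarrow> (LINT t|lborel. ?g t)"
  proof (rule integral_dominated_convergence)
    show "?g \<in> borel_measurable lborel"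
      using int[of "1 - z"] z by auto
    \<comment> \<open>The partial sums of \<open>exp (z * t)\<close> are at most
      \<open>exp (\<bar>z\<bar> * t)\<close>, and the remaining rate
      \<open>1 - \<bar>z\<bar>\<close> is positive.\<close>
    show "integrable lborel (\<lambda>t. norm (indicat_real {0<..} t * (exp (- (1 - \<bar>z\<bar>) * t) * P t)))"
      using z by (intro integrable_norm int) auto
    show "(\<lambda>t. \<Sum>k<N. ?f k t) \<in> borel_measurable lborel" for N
      by (rule borel_measurable_sum, rule borel_measurable_times[OF borel_measurable_const meas])
    show "AE t in lborel. (\<lambda>N. \<Sum>k<N. ?f k t) \<longlonglongrightarrow> ?g t"
    proof (rule AE_I2)
      fix t :: real
      have "(\<lambda>k. ?f k t) sums (exp (z * t) * (indicat_real {0<..} t * (exp (- t) * P t)))"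
        unfolding f_eq by (intro sums_mult2 exp_sums)
      also have "exp (z * t) * (indicat_real {0<..} t * (exp (- t) * P t)) = ?g t"
        by (simp add: algebra_simps exp_add exp_diff exp_minus divide_inverse)
      finally show "(\<lambda>N. \<Sum>k<N. ?f k t) \<longlonglongrightarrow> ?g t" by (simp add: sums_def)
    qed
    show "AE t in lborel. norm (\<Sum>k<N. ?f k t)
        \<le> norm (indicat_real {0<..} t * (exp (- (1 - \<bar>z\<bar>) * t) * P t))" for N
    proof (rule AE_I2)
      fix t :: real
      show "norm (\<Sum>k<N. ?f k t) \<le> norm (indicat_real {0<..} t * (exp (- (1 - \<bar>z\<bar>) * t) * P t))"
      proof (cases "t > 0")
        case True
        have "norm (\<Sum>k<N. ?f k t) \<le> (\<Sum>k<N. norm (?f k t))" by (rule norm_sum)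
        also have "\<dots> = (\<Sum>k<N. (\<bar>z\<bar> * t) ^ k / fact k) * (exp (- t) * \<bar>P t\<bar>)"
          unfolding f_eq sum_distrib_right using True
          by (intro sum.cong) (simp_all add: abs_mult power_abs)
        also have "\<dots> \<le> exp (\<bar>z\<bar> * t) * (exp (- t) * \<bar>P t\<bar>)"
        proof (rule mult_right_mono)
          show "(\<Sum>k<N. (\<bar>z\<bar> * t) ^ k / fact k) \<le> exp (\<bar>z\<bar> * t)"
            unfolding sums_unique[OF exp_sums]
            using True by (intro sum_le_suminf sums_summable[OF exp_sums]) auto
        qed auto
        also have "\<dots> = norm (indicat_real {0<..} t * (exp (- (1 - \<bar>z\<bar>) * t) * P t))"
          using True by (simp add: abs_mult algebra_simps exp_add exp_diff exp_minus divide_inverse)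
        finally show ?thesis .
      qed simp
    qed
  qed
  moreover have "(LINT t|lborel. (\<Sum>k<N. ?f k t)) =
      (\<Sum>k<N. (LINT t:{0<..}|lborel. exp (- t) * t ^ k * P t) / fact k * z ^ k)" for N
  proof -
    have "(LINT t|lborel. (\<Sum>k<N. ?f k t)) = (\<Sum>k<N. LINT t|lborel. ?f k t)"
      by (intro Bochner_Integration.integral_sum integrable_mult_right moment)
    also have "\<dots> = (\<Sum>k<N. z ^ k / fact k * (LINT t|lborel. indicat_real {0<..} t * (exp (- t) * t ^ k * P t)))"
      by (simp only: integral_mult_right_zero)
    finally show ?thesis
      by (simp add: set_lebesgue_integral_def mult_ac)
  qed
  moreover have "(LINT t|lborel. ?g t) = exp (- x * (1 - z) powr \<sigma>)"
    using integral_laplace_Wright_phi[OF x \<sigma>, of "1 - z"] z by (simp add: set_lebesgue_integral_def P_def)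
  ultimately show "(\<lambda>k. (LINT t:{0<..}|lborel. exp (- t) * t ^ k * P t) / fact k * z ^ k) sums exp (- x * (1 - z) powr \<sigma>)"
    by (simp add: sums_def)
qed

section \<open>The same generating function obtained from the Wright series\<close>

lemma abs_pochhammer_minus_le:
  fixes a :: real
  assumes "a \<ge> 0"
  shows "\<bar>pochhammer (- a) k\<bar> \<le> pochhammer a k"
  unfolding pochhammer_prod abs_prod using assms by (intro prod_mono) auto

text \<open>The binomial series at \<open>- z\<close> with exponent \<open>- a\<close>; the signs in
  the binomial coefficient and in \<open>(- z) ^ k\<close> cancel.\<close>

lemma pochhammer_sums_powr:
  fixes a z :: real
  assumes "\<bar>z\<bar> < 1"
  shows "(\<lambda>k. pochhammer a k / fact k * z ^ k) sums (1 - z) powr (- a)"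
proof -
  have "(\<lambda>k. ((- a) gchoose k) * (- z) ^ k) sums (1 - z) powr (- a)"
    using gen_binomial_real[of "- z" "- a"] assms by simp
  also have "(\<lambda>k. ((- a) gchoose k) * (- z) ^ k) = (\<lambda>k. pochhammer a k / fact k * z ^ k)"
  proof
    fix k
    have "(- 1) ^ k * (- z) ^ k = z ^ k"
      by (simp flip: power_mult_distrib)
    then show "((- a) gchoose k) * (- z) ^ k = pochhammer a k / fact k * z ^ k"
      by (simp add: gbinomial_pochhammer field_simps)
  qed
  finally show ?thesis .
qed

text \<open>For natural \<open>k\<close> the gamma quotient is
  \<open>pochhammer (- (\<sigma> * n)) k\<close>. Summing the double series over \<open>k\<close>
  first gives a binomial series, then an exponential series in \<open>n\<close>; summing over
  \<open>n\<close> first gives the values of \<open>Wright_Psi\<close>.\<close>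

lemma Wright_Psi_moments_sums:
  fixes x \<sigma> z :: real
  assumes x: "x > 0" and \<sigma>: "\<sigma> > 0" and z: "\<bar>z\<bar> < 1"
  shows "(\<lambda>k. Wright_Psi (- \<sigma>) (real k) (- x) / fact k * z ^ k) sums exp (- x * (1 - z) powr \<sigma>)"
proof -
  define f where "f n k = (- x) ^ n / fact n * (pochhammer (- (\<sigma> * real n)) k / fact k * z ^ k)" for n k
  \<comment> \<open>A majorant of \<open>f\<close> without signs: its sums over \<open>k\<close> are
    again binomial series, now with exponent \<open>- \<sigma> * n\<close>, and they add up to
    \<open>exp (x * (1 - \<bar>z\<bar>) powr (- \<sigma>))\<close>.\<close>
  define h where "h n k = x ^ n / fact n * (pochhammer (\<sigma> * real n) k / fact k * \<bar>z\<bar> ^ k)" for n k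
  have exp_sums: "(\<lambda>n. y ^ n / fact n * c powr (s * real n)) sums exp (y * c powr s)" if "c > 0" for y c s :: real
  proof -
    have "(\<lambda>n. (y * c powr s) ^ n /\<^sub>R fact n) sums exp (y * c powr s)"
      by (rule exp_converges)
    then show ?thesis
      using that by (simp add: power_mult_distrib powr_powr powr_realpow[symmetric] divide_inverse mult_ac)
  qed
  have h_sums: "h n sums (x ^ n / fact n * (1 - \<bar>z\<bar>) powr (- \<sigma> * real n))" for n
    unfolding h_def using pochhammer_sums_powr[of "\<bar>z\<bar>" "\<sigma> * real n"] z by (intro sums_mult) simp
  have h_nonneg: "h n k \<ge> 0" for n k
  proof -
    have "pochhammer (\<sigma> * real n) k \<ge> 0"
      unfolding pochhammer_prod using \<sigma> by (intro prod_nonneg) auto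
    then show ?thesis unfolding h_def using x by simp
  qed
  have h_has_sum: "(h n has_sum (x ^ n / fact n * (1 - \<bar>z\<bar>) powr (- \<sigma> * real n))) UNIV" for n
    by (rule sums_nonneg_imp_has_sum[OF h_sums h_nonneg])
  have h_summable: "(\<lambda>(n, k). h n k) summable_on UNIV \<times> UNIV"
  proof (rule summable_on_SigmaI)
    have "((\<lambda>n. x ^ n / fact n * (1 - \<bar>z\<bar>) powr (- \<sigma> * real n)) has_sum exp (x * (1 - \<bar>z\<bar>) powr (- \<sigma>))) UNIV"
      using exp_sums[of "1 - \<bar>z\<bar>" x "- \<sigma>"] z x by (intro sums_nonneg_imp_has_sum) auto
    then show "(\<lambda>n. x ^ n / fact n * (1 - \<bar>z\<bar>) powr (- \<sigma> * real n)) summable_on UNIV"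
      by (auto simp: summable_on_def)
  qed (use h_has_sum h_nonneg in auto)
  have f_le: "norm (f n k) \<le> h n k" for n k
  proof -
    have "\<bar>pochhammer (- (\<sigma> * real n)) k\<bar> \<le> pochhammer (\<sigma> * real n) k"
      using \<sigma> by (intro abs_pochhammer_minus_le) simp
    then show ?thesis
      unfolding f_def h_def using x
      by (simp add: abs_mult power_abs mult_left_mono mult_right_mono divide_right_mono)
  qed
  have "(\<lambda>p. norm (case p of (n, k) \<Rightarrow> f n k)) summable_on UNIV \<times> UNIV"
    by (rule summable_on_comparison_test[OF h_summable]) (use f_le in auto)
  then have f_summable: "(\<lambda>(n, k). f n k) summable_on UNIV \<times> UNIV"
    by (rule abs_summable_summable)
  have f_swap: "(\<lambda>(k, n). f n k) summable_on UNIV \<times> UNIV"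
    using f_summable by (subst summable_on_swap) simp
  have f_sums1: "(\<Sum>\<^sub>\<infinity>k. f n k) = (- x) ^ n / fact n * (1 - z) powr (\<sigma> * real n)" for n
  proof -
    have "f n summable_on UNIV"
      using summable_on_SigmaD1[OF f_summable, of n] by simp
    then have "f n sums (\<Sum>\<^sub>\<infinity>k. f n k)"
      by (intro has_sum_imp_sums) simp
    moreover have "f n sums ((- x) ^ n / fact n * (1 - z) powr (\<sigma> * real n))"
      unfolding f_def using pochhammer_sums_powr[OF z, of "- (\<sigma> * real n)"] by (intro sums_mult) simp
    ultimately show ?thesis by (rule sums_unique2)
  qed
  have f_sums2: "(\<Sum>\<^sub>\<infinity>n. f n k) = Wright_Psi (- \<sigma>) (real k) (- x) / fact k * z ^ k" for k
  proof -
    have "(\<lambda>n. f n k) summable_on UNIV"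
      using summable_on_SigmaD1[OF f_swap, of k] by simp
    then have "(\<lambda>n. f n k) sums (\<Sum>\<^sub>\<infinity>n. f n k)"
      by (intro has_sum_imp_sums) simp
    moreover have "f n k = Gamma_quotient (- \<sigma> * real n) (real k) * (- x) ^ n / fact n * (z ^ k / fact k)" for n
      by (simp add: f_def Gamma_quotient_of_nat pochhammer_prod atLeast0LessThan)
    ultimately have s: "(\<lambda>n. Gamma_quotient (- \<sigma> * real n) (real k) * (- x) ^ n / fact n * (z ^ k / fact k)) sums (\<Sum>\<^sub>\<infinity>n. f n k)"
      by simp
    show ?thesis
    \<comment> \<open>The factor \<open>z ^ k / fact k\<close> is divided out to get convergence of
      the Wright series. For \<open>z = 0\<close> and \<open>k > 0\<close> this is impossible, but
      then both sides are 0.\<close>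
    proof (cases "z ^ k = 0")
      case True
      then have "f n k = 0" for n by (simp add: f_def)
      then show ?thesis by (simp only: True) simp
    next
      case False
      then have "(\<lambda>n. Gamma_quotient (- \<sigma> * real n) (real k) * (- x) ^ n / fact n) sums
          ((\<Sum>\<^sub>\<infinity>n. f n k) / (z ^ k / fact k))"
        using s by (subst sums_mult2_iff[of "z ^ k / fact k", symmetric]) auto
      then have "Wright_Psi (- \<sigma>) (real k) (- x) = (\<Sum>\<^sub>\<infinity>n. f n k) / (z ^ k / fact k)"
        unfolding Wright_Psi_def by (rule sums_unique[symmetric])
      then show ?thesis using False by simp
    qed
  qed
  have "(\<lambda>k. \<Sum>\<^sub>\<infinity>n. f n k) summable_on UNIV"
    by (rule summable_on_Sigma_banach[OF f_swap])
  then have "(\<lambda>k. \<Sum>\<^sub>\<infinity>n. f n k) sums (\<Sum>\<^sub>\<infinity>k. \<Sum>\<^sub>\<infinity>n. f n k)"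
    by (intro has_sum_imp_sums) simp
  also have "(\<Sum>\<^sub>\<infinity>k. \<Sum>\<^sub>\<infinity>n. f n k) = (\<Sum>\<^sub>\<infinity>n. \<Sum>\<^sub>\<infinity>k. f n k)"
    by (rule infsum_swap_banach[OF f_swap])
  also have "\<dots> = exp (- x * (1 - z) powr \<sigma>)"
  proof -
    have "(\<lambda>n. \<Sum>\<^sub>\<infinity>k. f n k) summable_on UNIV"
      by (rule summable_on_Sigma_banach[OF f_summable])
    then have "(\<lambda>n. \<Sum>\<^sub>\<infinity>k. f n k) sums (\<Sum>\<^sub>\<infinity>n. \<Sum>\<^sub>\<infinity>k. f n k)"
      by (intro has_sum_imp_sums) simp
    then show ?thesis
      unfolding f_sums1 by (rule sums_unique2) (use exp_sums[of "1 - z" "- x" \<sigma>] z in auto)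
  qed
  finally show ?thesis unfolding f_sums2 .
qed

text \<open>The moments and the Wright values, each divided by \<open>fact k\<close>, are
  coefficients of one and the same power series on \<open>\<bar>z\<bar> < 1\<close>.\<close>

lemma
  fixes x \<rho> :: real
  assumes x: "x > 0" and \<rho>: "-1 < \<rho>" "\<rho> < 0"
  shows Wright_integral_negative_integrable: "set_integrable lborel {0<..}
      (\<lambda>t. exp (- t) * t powr (real k - 1) * Wright_phi \<rho> (- x * t powr \<rho>))"
    and Wright_integral_negative: "(LINT t:{0<..}|lborel. exp (- t) * t powr (real k - 1) * Wright_phi \<rho> (- x * t powr \<rho>))
      = Wright_Psi \<rho> (real k) (- x)"
proof -
  define \<sigma> where "\<sigma> = - \<rho>"
  have \<sigma>: "0 < \<sigma>" "\<sigma> < 1" and \<rho>_eq: "\<rho> = - \<sigma>" using \<rho> by (auto simp: \<sigma>_def)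
  have eq: "exp (- t) * t ^ k * (Wright_phi (- \<sigma>) (- x * t powr (- \<sigma>)) / t) =
      exp (- t) * t powr (real k - 1) * Wright_phi \<rho> (- x * t powr \<rho>)" if "t \<in> {0<..}" for t
    using that by (simp add: \<rho>_eq powr_diff powr_realpow)
  show "set_integrable lborel {0<..}
      (\<lambda>t. exp (- t) * t powr (real k - 1) * Wright_phi \<rho> (- x * t powr \<rho>))"
    using integrable_moment_Wright_phi[OF x \<sigma>, of k]
    by (subst (asm) set_integrable_cong[OF refl refl eq]) auto
  let ?M = "\<lambda>k. LINT t:{0<..}|lborel. exp (- t) * t ^ k * (Wright_phi (- \<sigma>) (- x * t powr (- \<sigma>)) / t)"
  have "(\<lambda>k. ?M k / fact k) = (\<lambda>k. Wright_Psi (- \<sigma>) (real k) (- x) / fact k)"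
    by (rule power_series_unique[OF zero_less_one moments_Wright_phi_sums[OF x \<sigma>] Wright_Psi_moments_sums[OF x \<sigma>(1)]])
  then have "?M k / fact k = Wright_Psi (- \<sigma>) (real k) (- x) / fact k"
    by (rule fun_cong)
  then have "?M k = Wright_Psi \<rho> (real k) (- x)" by (simp add: \<rho>_eq)
  moreover have "?M k = (LINT t:{0<..}|lborel. exp (- t) * t powr (real k - 1) * Wright_phi \<rho> (- x * t powr \<rho>))"
    by (rule set_lebesgue_integral_cong) (use eq in auto)
  ultimately show "(LINT t:{0<..}|lborel. exp (- t) * t powr (real k - 1) * Wright_phi \<rho> (- x * t powr \<rho>))
      = Wright_Psi \<rho> (real k) (- x)" by simp
qed

section \<open>Positive parameter\<close>

text \<open>Shifting the argument by a fixed \<open>k\<close> costs at most a factor exponential in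
  \<open>a\<close>, which a factorial denominator can absorb. The non-integer shift is reduced to
  the shifts 0 and \<open>m\<close>, the latter being a Pochhammer product.\<close>

lemma Gamma_add_le:
  fixes a k :: real
  assumes a: "a > 0" and k: "0 \<le> k" "k \<le> real m"
  shows "Gamma (a + k) \<le> Gamma a * (1 + fact m * exp (a + m))"
proof -
  have "Gamma (a + k) = (LINT t:{0<..}|lborel. t powr (a + k - 1) / exp t)"
    using set_integral_Gamma[of "a + k"] a k by simp
  also have "\<dots> \<le> (LINT t:{0<..}|lborel. t powr (a - 1) / exp t + t powr (a + m - 1) / exp t)"
  proof (rule set_integral_mono)
    show "set_integrable lborel {0<..} (\<lambda>t. t powr (a + k - 1) / exp t)"
      using a k by (intro set_integrable_Gamma) auto
    show "set_integrable lborel {0<..} (\<lambda>t. t powr (a - 1) / exp t + t powr (a + m - 1) / exp t)"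
      using a by (intro set_integral_add set_integrable_Gamma) auto
    fix t :: real assume "t \<in> {0<..}"
    then have t: "t > 0" by simp
    \<comment> \<open>For \<open>t \<le> 1\<close> the smallest exponent dominates, for
      \<open>t > 1\<close> the largest; the sum covers both.\<close>
    have "t powr (a + k - 1) \<le> t powr (a - 1) + t powr (a + m - 1)"
    proof (cases "t \<le> 1")
      case True
      then have "t powr (a + k - 1) \<le> t powr (a - 1)" using t k by (intro powr_mono') auto
      then show ?thesis by (simp add: add_increasing2)
    next
      case False
      then have "t powr (a + k - 1) \<le> t powr (a + m - 1)" using k by (intro powr_mono) auto
      then show ?thesis by (simp add: add_increasing)
    qed
    then show "t powr (a + k - 1) / exp t \<le> t powr (a - 1) / exp t + t powr (a + m - 1) / exp t"
      by (simp flip: add_divide_distrib add: divide_right_mono)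
  qed
  also have "\<dots> = Gamma a + Gamma (a + m)"
    using set_integral_Gamma[of a] set_integral_Gamma[of "a + m"] set_integrable_Gamma[of a] set_integrable_Gamma[of "a + m"] a
    by (subst set_integral_add) auto
  also have "Gamma (a + m) = Gamma a * pochhammer a m"
  proof -
    have "a \<notin> \<int>\<^sub>\<le>\<^sub>0" using a by (auto elim!: nonpos_Ints_cases')
    then show ?thesis
      using pochhammer_Gamma[of a m] less_imp_neq[OF Gamma_real_pos[OF a]] by simp
  qed
  also have "pochhammer a m \<le> fact m * exp (a + m)"
  proof -
    have "pochhammer a m \<le> (\<Prod>i<m. a + m)"
      unfolding pochhammer_prod atLeast0LessThan using a by (intro prod_mono) auto
    also have "\<dots> = (a + m) ^ m" by simp
    also have "\<dots> \<le> fact m * exp (a + m)" using a by (intro power_le_fact_mult_exp) auto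
    finally show ?thesis .
  qed
  finally show ?thesis
    using Gamma_real_pos[OF a] by (simp add: algebra_simps)
qed

text \<open>By monotone convergence the sum of the norms has a finite integral, so it is finite
  almost everywhere.\<close>

lemma AE_summable_norm:
  fixes f :: "nat \<Rightarrow> 'a \<Rightarrow> 'b :: {banach, second_countable_topology}"
  assumes f: "\<And>n. integrable M (f n)" and s: "summable (\<lambda>n. LINT x|M. norm (f n x))"
  shows "AE x in M. summable (\<lambda>n. norm (f n x))"
proof -
  have [measurable]: "f n \<in> borel_measurable M" for n using f by auto
  have "(\<integral>\<^sup>+ x. (\<Sum>n. ennreal (norm (f n x))) \<partial>M) = (\<Sum>n. \<integral>\<^sup>+ x. ennreal (norm (f n x)) \<partial>M)"
    by (rule nn_integral_suminf) auto
  also have "\<dots> = (\<Sum>n. ennreal (LINT x|M. norm (f n x)))"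
    using f by (intro suminf_cong nn_integral_eq_integral) auto
  also have "\<dots> \<noteq> \<infinity>"
    using s by (subst suminf_ennreal2) auto
  finally have "AE x in M. (\<Sum>n. ennreal (norm (f n x))) \<noteq> \<infinity>"
    by (intro nn_integral_noteq_infinite) auto
  then show ?thesis
    by eventually_elim (intro summable_suminf_not_top, auto)
qed

text \<open>All terms are nonnegative on the half-line, and the term of exponent
  \<open>Suc n\<close> integrates to \<open>c n * Gamma (a n + k)\<close>; summability of these
  values justifies the interchange.\<close>

lemma
  fixes x \<rho> k :: real
  assumes x: "x > 0" and \<rho>: "\<rho> > 0" and k: "k \<ge> 0"
  shows Wright_integral_positive_integrable: "set_integrable lborel {0<..}
      (\<lambda>t. exp (- t) * t powr (k - 1) * Wright_phi \<rho> (x * t powr \<rho>))"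
    and Wright_integral_positive: "(LINT t:{0<..}|lborel. exp (- t) * t powr (k - 1) * Wright_phi \<rho> (x * t powr \<rho>))
      = (if k = 0 then Wright_Psi \<rho> k x - 1 else Wright_Psi \<rho> k x)"
proof -
  define a where "a n = \<rho> * real (Suc n)" for n
  have a: "a n > 0" for n using \<rho> by (simp add: a_def)
  define c where "c n = x ^ Suc n / fact (Suc n) * rGamma (a n)" for n
  have rGamma_eq: "rGamma (a n) = inverse (Gamma (a n))" for n
    by (rule rGamma_inverse_Gamma)
  have c_nonneg: "c n \<ge> 0" for n
    unfolding c_def rGamma_eq using x Gamma_real_pos[OF a[of n]] by simp
  define f where "f n t = indicat_real {0<..} t *\<^sub>R (c n * (t powr (a n + k - 1) / exp t))" for n t
  have f_nonneg: "f n t \<ge> 0" for n t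
    using c_nonneg by (simp add: f_def)
  have f_int: "integrable lborel (f n)" for n
    using set_integrable_mult_right[where a = "c n", OF set_integrable_Gamma[of "a n + k"]] a[of n] k
    unfolding f_def set_integrable_def by simp
  have f_integral: "(LINT t|lborel. f n t) = c n * Gamma (a n + k)" for n
  proof -
    have "(LINT t|lborel. f n t) = (LINT t:{0<..}|lborel. c n * (t powr (a n + k - 1) / exp t))"
      unfolding f_def set_lebesgue_integral_def ..
    also have "\<dots> = c n * (LINT t:{0<..}|lborel. t powr (a n + k - 1) / exp t)"
      by (rule set_integral_mult_right)
    also have "\<dots> = c n * Gamma (a n + k)"
      using set_integral_Gamma[of "a n + k"] a[of n] k by simp
    finally show ?thesis .
  qed
  have summable: "summable (\<lambda>n. c n * Gamma (a n + k))"
  proof (rule summable_comparison_test')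
    define m where "m = nat \<lceil>k\<rceil>"
    have m: "k \<le> real m" unfolding m_def by (rule real_nat_ceiling_ge)
    have 1: "summable (\<lambda>n. y ^ Suc n /\<^sub>R fact (Suc n))" for y :: real
      by (subst summable_Suc_iff) (rule summable_exp_generic)
    \<comment> \<open>By \<open>Gamma_add_le\<close> the gamma quotient is at most
      \<open>1 + fact m * exp (a n + m)\<close>; as \<open>a n\<close> is linear in
      \<open>n\<close>, two exponential series, at \<open>x\<close> and at
      \<open>x * exp \<rho>\<close>, serve as majorant.\<close>
    show "summable (\<lambda>n. x ^ Suc n /\<^sub>R fact (Suc n) + fact m * exp m * ((x * exp \<rho>) ^ Suc n /\<^sub>R fact (Suc n)))"
      by (intro summable_add summable_mult 1)
    fix n
    have "norm (c n * Gamma (a n + k)) = c n * Gamma (a n + k)"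
      using c_nonneg[of n] Gamma_real_pos[of "a n + k"] a[of n] k by simp
    also have "\<dots> \<le> c n * (Gamma (a n) * (1 + fact m * exp (a n + m)))"
      by (intro mult_left_mono Gamma_add_le a k m c_nonneg)
    also have "\<dots> = x ^ Suc n / fact (Suc n) * (1 + fact m * exp (a n + m))"
      using less_imp_neq[OF Gamma_real_pos[OF a[of n]]] unfolding c_def rGamma_eq by simp
    also have "exp (a n + m) = exp m * exp \<rho> ^ Suc n"
      unfolding a_def exp_add mult.commute[of \<rho> "real (Suc n)"] exp_of_nat_mult by (rule mult.commute)
    finally show "norm (c n * Gamma (a n + k)) \<le>
        x ^ Suc n /\<^sub>R fact (Suc n) + fact m * exp m * ((x * exp \<rho>) ^ Suc n /\<^sub>R fact (Suc n))"
      by (simp add: power_mult_distrib divide_inverse algebra_simps del: power_Suc fact_Suc)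
  qed
  have summable_norm: "summable (\<lambda>n. LINT t|lborel. norm (f n t))"
    using summable f_nonneg by (simp add: f_integral)
  have f_suminf: "(\<Sum>n. f n t) = indicat_real {0<..} t *\<^sub>R (exp (- t) * t powr (k - 1) * Wright_phi \<rho> (x * t powr \<rho>))"
    if "summable (\<lambda>n. norm (f n t))" for t
  proof (cases "t > 0")
    case True
    have f_eq: "f n t = exp (- t) * t powr (k - 1) *
        ((x * t powr \<rho>) ^ Suc n / fact (Suc n) * rGamma (\<rho> * real (Suc n)))" for n
    proof -
      have "t powr (a n + k - 1) = t powr (k - 1) * t powr (a n)"
        by (simp add: algebra_simps flip: powr_add)
      also have "t powr (a n) = (t powr \<rho>) ^ Suc n"
        unfolding a_def powr_powr[symmetric] using True by (intro powr_realpow) simp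
      finally show ?thesis
        using True by (simp add: f_def c_def a_def power_mult_distrib exp_minus field_simps)
    qed
    have "summable (\<lambda>n. f n t)" using that by (rule summable_norm_cancel)
    then have "summable (\<lambda>n. (x * t powr \<rho>) ^ Suc n / fact (Suc n) * rGamma (\<rho> * real (Suc n)))"
      unfolding f_eq by (rule summable_mult_D) (use True in simp)
    then have "(\<Sum>n. f n t) = exp (- t) * t powr (k - 1) * Wright_phi \<rho> (x * t powr \<rho>)"
      unfolding f_eq Wright_phi_def by (rule suminf_mult)
    then show ?thesis using True by simp
  next
    case False
    then show ?thesis by (simp add: f_def)
  qed
  have AE_sum: "AE t in lborel. summable (\<lambda>n. norm (f n t))"
    by (rule AE_summable_norm[OF f_int summable_norm])
  let ?F = "\<lambda>t. indicat_real {0<..} t *\<^sub>R (exp (- t) * t powr (k - 1) * Wright_phi \<rho> (x * t powr \<rho>))"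
  have AE_eq: "AE t in lborel. (\<Sum>n. f n t) = ?F t"
    using AE_sum by eventually_elim (rule f_suminf)
  \<comment> \<open>\<open>lborel\<close> is not complete, so measurability does not follow from the almost everywhere identity.\<close>
  have F_meas: "?F \<in> borel_measurable lborel"
    unfolding Wright_phi_def by measurable
  have f_meas: "(\<lambda>t. \<Sum>n. f n t) \<in> borel_measurable lborel"
    using f_int by (intro borel_measurable_suminf borel_measurable_integrable)
  have "integrable lborel (\<lambda>t. \<Sum>n. f n t)"
    by (rule integrable_suminf[OF f_int AE_sum summable_norm])
  then have "integrable lborel ?F"
    by (rule integrable_cong_AE[THEN iffD1, OF f_meas F_meas AE_eq])
  then show "set_integrable lborel {0<..} (\<lambda>t. exp (- t) * t powr (k - 1) * Wright_phi \<rho> (x * t powr \<rho>))"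
    unfolding set_integrable_def .
  have "(LINT t|lborel. ?F t) = (LINT t|lborel. (\<Sum>n. f n t))"
    by (rule integral_cong_AE[OF f_meas F_meas AE_eq, symmetric])
  then have c_sums: "(\<lambda>n. c n * Gamma (a n + k)) sums (LINT t|lborel. ?F t)"
    using sums_integral[OF f_int AE_sum summable_norm] by (simp add: f_integral)
  have c_eq: "c n * Gamma (a n + k) = Gamma_quotient (\<rho> * real (Suc n)) k * x ^ Suc n / fact (Suc n)" for n
  proof -
    have "\<rho> * real (Suc n) \<notin> \<int>\<^sub>\<le>\<^sub>0"
      using a[of n] by (auto simp: a_def elim!: nonpos_Ints_cases')
    then show ?thesis by (simp add: Gamma_quotient_def c_def a_def)
  qed
  \<comment> \<open>The term of index 0, absent from \<open>Wright_phi\<close>, is put back: it is 1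
    for \<open>k = 0\<close> and 0 for \<open>k > 0\<close>.\<close>
  have "(\<lambda>n. Gamma_quotient (\<rho> * real n) k * x ^ n / fact n) sums
      ((LINT t|lborel. ?F t) + Gamma_quotient (\<rho> * real 0) k * x ^ 0 / fact 0)"
    using c_sums unfolding c_eq by (subst (asm) sums_Suc_iff) simp
  then have "Wright_Psi \<rho> k x = (LINT t|lborel. ?F t) + Gamma_quotient (\<rho> * real 0) k * x ^ 0 / fact 0"
    unfolding Wright_Psi_def by (rule sums_unique[symmetric])
  moreover have "Gamma_quotient 0 k = (if k = 0 then 1 else 0)"
    using k Gamma_quotient_0_left[of k] Gamma_quotient_of_nat[of 0 0] by simp
  ultimately have "(LINT t|lborel. ?F t) = (if k = 0 then Wright_Psi \<rho> k x - 1 else Wright_Psi \<rho> k x)"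
    by auto
  then show "(LINT t:{0<..}|lborel. exp (- t) * t powr (k - 1) * Wright_phi \<rho> (x * t powr \<rho>))
      = (if k = 0 then Wright_Psi \<rho> k x - 1 else Wright_Psi \<rho> k x)"
    unfolding set_lebesgue_integral_def .
qed

text \<open>For \<open>\<rho> > 0\<close> and \<open>k = 0\<close> the integral misses the constant
  term 1 of \<open>Wright_Psi\<close>, hence the correction \<open>- 1\<close>. For negative
  \<open>\<rho>\<close> none arises: at \<open>k = 0\<close> the integral is the Laplace transform
  at \<open>q = 1\<close>, that is \<open>exp (- x)\<close>. Integrability is stated separately
  because a non-integrable function has integral 0 by convention.\<close>

theorem mainTheorem1:
  fixes x :: real
  assumes "x > 0"
  shows
    "(\<forall>\<rho> k :: real. \<rho> > 0 \<and> k \<ge> 0 \<longrightarrow>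
        set_integrable lborel {0<..}
          (\<lambda>\<tau>. exp (- \<tau>) * \<tau> powr (k - 1) * Wright_phi \<rho> (x * \<tau> powr \<rho>)) \<and>
        (LINT \<tau>:{0<..}|lborel. exp (- \<tau>) * \<tau> powr (k - 1) * Wright_phi \<rho> (x * \<tau> powr \<rho>))
          = (if k = 0 then Wright_Psi \<rho> k x - 1 else Wright_Psi \<rho> k x)) \<and>
     (\<forall>(\<rho> :: real) (k :: nat). -1 < \<rho> \<and> \<rho> < 0 \<longrightarrow>
        set_integrable lborel {0<..}
          (\<lambda>\<tau>. exp (- \<tau>) * \<tau> powr (real k - 1) * Wright_phi \<rho> (- x * \<tau> powr \<rho>)) \<and>
        (LINT \<tau>:{0<..}|lborel. exp (- \<tau>) * \<tau> powr (real k - 1) * Wright_phi \<rho> (- x * \<tau> powr \<rho>))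
          = Wright_Psi \<rho> (real k) (- x))"
  using Wright_integral_positive_integrable[OF assms] Wright_integral_positive[OF assms]
    Wright_integral_negative_integrable[OF assms] Wright_integral_negative[OF assms]
  by blast

end
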